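(* Consider the algorithm VRCS (described in the context) applied to $\min_{x\in\mathbb{R}^d}h(x)$, $h=f+g$, where $h$ is $\mu$-strongly convex with $\mu>0$ (i.e. $h(x)\ge h(y)+\langle\nabla h(y),x-y\rangle+\frac{\mu}{2}\|x-y\|^2$ for all $x,y\in\mathbb{R}^d$), and $\|\nabla^2 f_1(x)-\nabla^2 f(x)\|\le\delta_f$, $\|\nabla^2 g_1(x)-\nabla^2 g(x)\|\le\delta_g$ for all $x\in\mathbb{R}^d$, with $\mu<\delta_f<\delta_g$. Let every subproblem within every epoch be solved approximately so that $$\mathbb{E}\left[\|\nabla A_\theta^t(x_{t+1})\|^2\right]\le\mathbb{E}\left[\frac{\mu}{17\theta}\Big\|x_t-\arg\min_{x\in\mathbb{R}^d}A_\theta^t(x)\Big\|^2\right],$$ and choose $$\theta=\frac14\sqrt{\frac{p(1-p)q}{p\delta_g^2+(1-p)\delta_f^2}},\qquad p=q=\frac{\delta_f^2}{\delta_f^2+\delta_g^2}.$$ Then the (expected) number of communication rounds needed to reach an $\varepsilon$-solution is $$\mathcal{O}\left(\frac{\delta_f}{\mu}\log\frac1\varepsilon\right)\ \text{for the nodes from } M_f,\qquad \mathcal{O}\left(\left(\frac{\delta_g}{\delta_f}\right)\frac{\delta_g}{\mu}\log\frac1\varepsilon\right)\ \text{for the nodes from } M_g.$$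
   Context: Problem: $\min_{x\in\mathbb{R}^d} h(x)$, $h=f+g$, with $f=\frac{1}{|M_f|}\sum_{m\in M_f}f_m$ and $g=\frac{1}{|M_g|}\sum_{m\in M_g}g_m$, all functions twice differentiable on $\mathbb{R}^d$ and otherwise arbitrary (in particular $f,g$ may be non-convex). $M_f,M_g$ are finite sets of nodes. A server holds $f_1$ and $g_1$, and $h_1=f_1+g_1$. $x_*$ denotes the minimizer of $h$. Norms are Euclidean for vectors and operator (spectral) for matrices. Communication rounds: computations with $f_1,g_1,h_1$ are free. Each evaluation of $\nabla f$ (or $\nabla(f-f_1)$) at a point costs one communication round for the nodes of $M_f$; each evaluation of $\nabla g$ (or $\nabla(g-g_1)$) at a point costs one communication round for the nodes of $M_g$; evaluating $\nabla h$ costs one round of each. Values already computed can be reused. One epoch $\mathrm{VRCS}^{1ep}(p,q,\theta,x_0)$, with $x_0\in\mathbb{R}^d$, $p,q\in(0,1)$, $\theta>0$: draw $T\sim\mathrm{Geom}(q)$, i.e. $\mathbb{P}(T=j)=q(1-q)^{j-1}$ for $j\ge1$. For $t=0,\dots,T-1$: 1. Draw $i_t\sim\mathrm{Bernoulli}(p)$. 2. If $i_t=1$: $\xi_t=\frac1p\nabla(f-f_1)(x_t)$ and $\zeta_t=\frac1p\nabla(f-f_1)(x_0)$. If $i_t=0$: $\xi_t=\frac{1}{1-p}\nabla(g-g_1)(x_t)$ and $\zeta_t=\frac{1}{1-p}\nabla(g-g_1)(x_0)$. 3. $e_t=\xi_t-\zeta_t+\nabla h(x_0)-\nabla h_1(x_0)$.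 4. $x_{t+1}\approx\arg\min_x A_\theta^t(x)$, where $A_\theta^t(x)=\langle e_t,x\rangle+\frac{1}{2\theta}\|x-x_t\|^2+h_1(x)$. Output $x_T$. All random draws are mutually independent. VRCS: from $x_0\in\mathbb{R}^d$, for $k=0,\dots,K-1$ set $x_{k+1}=\mathrm{VRCS}^{1ep}(p,q,\theta,x_k)$; output $x_K$. An $\varepsilon$-solution means that the output satisfies $\mathbb{E}[h(x_K)-h(x_* )]\le\varepsilon$. $\mathcal{O}(\cdot)$ hides absolute constants, and $\log\frac1\varepsilon$ is understood up to the dependence of its argument on the initial point (i.e. $\log\frac{C_0}{\varepsilon}$ with $C_0$ determined by the initial error). *)

theory Defs
  imports "HOL-Probability.Probability"
begin

section \<open>Gradients, Hessians, strong convexity\<close>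

definition grad :: "('a::real_inner \<Rightarrow> real) \<Rightarrow> 'a \<Rightarrow> 'a" where
  "grad \<phi> x = (THE D. GDERIV \<phi> x :> D)"

definition hess :: "(real^'d \<Rightarrow> real) \<Rightarrow> real^'d \<Rightarrow> real^'d^'d" where
  "hess \<phi> x = jacobian (grad \<phi>) (at x)"

definition twice_differentiable :: "(real^'d \<Rightarrow> real) \<Rightarrow> bool" where
  "twice_differentiable \<phi> \<longleftrightarrow>
     (\<forall>x. \<phi> differentiable (at x)) \<and> (\<forall>x. grad \<phi> differentiable (at x))"

definition spectral_norm :: "real^'d^'d \<Rightarrow> real" where
  "spectral_norm A = onorm ((*v) A)"

definition strongly_convex :: "real \<Rightarrow> ('a::real_inner \<Rightarrow> real) \<Rightarrow> bool" where
  "strongly_convex \<mu> \<phi> \<longleftrightarrow>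
     (\<forall>x y. \<phi> x \<ge> \<phi> y + grad \<phi> y \<bullet> (x - y) + \<mu> / 2 * (norm (x - y))\<^sup>2)"

definition average :: "'m set \<Rightarrow> ('m \<Rightarrow> 'a \<Rightarrow> real) \<Rightarrow> 'a \<Rightarrow> real" where
  "average I \<phi> x = 1 / real (card I) * (\<Sum>m\<in>I. \<phi> m x)"

section \<open>The algorithm\<close>

definition vrcs_sample ::
  "('a::real_inner \<Rightarrow> real) \<Rightarrow> ('a \<Rightarrow> real) \<Rightarrow> ('a \<Rightarrow> real) \<Rightarrow> ('a \<Rightarrow> real) \<Rightarrow> real \<Rightarrow> bool \<Rightarrow> 'a \<Rightarrow> 'a"
where
  "vrcs_sample f f1 g g1 p b x =
     (if b then (1 / p) *\<^sub>R grad (\<lambda>z. f z - f1 z) x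
           else (1 / (1 - p)) *\<^sub>R grad (\<lambda>z. g z - g1 z) x)"

text \<open>\<open>vrcs_dir f f1 g g1 p b x0 x\<close> is the direction \<open>e\<^sub>t\<close> for the Bernoulli outcome
  \<open>b\<close> (\<open>True\<close> is \<open>i\<^sub>t = 1\<close>), the epoch's starting point \<open>x0\<close> and the
  current point \<open>x\<close>.\<close>

definition vrcs_dir ::
  "('a::real_inner \<Rightarrow> real) \<Rightarrow> ('a \<Rightarrow> real) \<Rightarrow> ('a \<Rightarrow> real) \<Rightarrow> ('a \<Rightarrow> real) \<Rightarrow> real \<Rightarrow> bool \<Rightarrow> 'a \<Rightarrow> 'a \<Rightarrow> 'a"
where
  "vrcs_dir f f1 g g1 p b x0 x =
     vrcs_sample f f1 g g1 p b x - vrcs_sample f f1 g g1 p b x0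
       + grad (\<lambda>z. f z + g z) x0 - grad (\<lambda>z. f1 z + g1 z) x0"

definition vrcs_subproblem ::
  "('a::real_inner \<Rightarrow> real) \<Rightarrow> ('a \<Rightarrow> real) \<Rightarrow> real \<Rightarrow> 'a \<Rightarrow> 'a \<Rightarrow> 'a \<Rightarrow> real"
where
  "vrcs_subproblem f1 g1 \<theta> e xt x =
     e \<bullet> x + 1 / (2 * \<theta>) * (norm (x - xt))\<^sup>2 + (f1 x + g1 x)"

text \<open>
  \<open>vrcs_run\<close> describes an execution of \<open>K\<close> epochs on a probability space \<open>M\<close>:
  \<open>x k\<close> is the point from which epoch \<open>k\<close> starts (so \<open>x K\<close> is the output),
  \<open>T k\<close> the length of epoch \<open>k\<close>, \<open>b k t\<close> its Bernoulli draws
  and \<open>y k t\<close> its inner iterates.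

  The inner iterates and draws of an epoch are indexed by all \<open>t\<close>; only those up to \<open>T k\<close>
  are used. This gives meaning to expectations at a fixed \<open>t\<close>, and it expresses that a
  subproblem solver does not anticipate the length of the epoch.

  \<open>F k t\<close> is the information available at the start of step \<open>t\<close> of epoch \<open>k\<close>.
  It may contain internal randomness of the subproblem solver. Each \<open>b k t\<close> is independent of the
  information preceding it, and \<open>T k\<close> is independent of all the information of its epoch, in
  particular of all \<open>b k t\<close> and of the earlier epochs. Hence all the draws \<open>b k t\<close>,
  \<open>T k\<close> are mutually independent.

  \<open>geometric_pmf q\<close> counts failures and lives on \<open>{0..}\<close>; shifted by one it gives
  \<open>q * (1 - q) ^ (j - 1)\<close> for \<open>j \<ge> 1\<close>.

  The expectations in the accuracy condition are taken in \<open>[0, \<infinity>]\<close>, so that the condition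
  cannot hold merely because a Bochner integral is undefined.
\<close>

locale vrcs_run = prob_space M
  for M :: "'w measure" and K :: nat
    and f f1 g g1 :: "real^'d \<Rightarrow> real" and p q \<theta> \<mu> :: real and x0 :: "real^'d"
    and F :: "nat \<Rightarrow> nat \<Rightarrow> 'w measure"
    and T :: "nat \<Rightarrow> 'w \<Rightarrow> nat"
    and b :: "nat \<Rightarrow> nat \<Rightarrow> 'w \<Rightarrow> bool"
    and x :: "nat \<Rightarrow> 'w \<Rightarrow> real^'d"
    and y :: "nat \<Rightarrow> nat \<Rightarrow> 'w \<Rightarrow> real^'d" +
  assumes F_sub: "\<And>k t. k < K \<Longrightarrow> subalgebra M (F k t)"
    and F_step: "\<And>k t. k < K \<Longrightarrow> sets (F k t) \<subseteq> sets (F k (Suc t))"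
    and F_epoch: "\<And>k t. Suc k < K \<Longrightarrow> sets (F k t) \<subseteq> sets (F (Suc k) 0)"
    and T_distr: "\<And>k. k < K \<Longrightarrow> T k \<in> measurable M (count_space UNIV) \<and>
          distr M (count_space UNIV) (T k) = measure_pmf (map_pmf Suc (geometric_pmf q))"
    and T_indep: "\<And>k t. k < K \<Longrightarrow>
          indep_set (sets (F k t)) (sets (vimage_algebra (space M) (T k) (count_space UNIV)))"
    and T_epoch: "\<And>k. Suc k < K \<Longrightarrow> T k \<in> measurable (F (Suc k) 0) (count_space UNIV)"
    and b_distr: "\<And>k t. k < K \<Longrightarrow>
          distr M (count_space UNIV) (b k t) = measure_pmf (bernoulli_pmf p)"
    and b_adapted: "\<And>k t. k < K \<Longrightarrow> b k t \<in> measurable (F k (Suc t)) (count_space UNIV)"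
    and b_indep: "\<And>k t. k < K \<Longrightarrow>
          indep_set (sets (F k t)) (sets (vimage_algebra (space M) (b k t) (count_space UNIV)))"
    and y_adapted: "\<And>k t. k < K \<Longrightarrow> y k t \<in> borel_measurable (F k t)"
    and x_init: "\<And>\<omega>. \<omega> \<in> space M \<Longrightarrow> x 0 \<omega> = x0"
    and y_init: "\<And>k \<omega>. k < K \<Longrightarrow> \<omega> \<in> space M \<Longrightarrow> y k 0 \<omega> = x k \<omega>"
    and x_next: "\<And>k \<omega>. k < K \<Longrightarrow> \<omega> \<in> space M \<Longrightarrow> x (Suc k) \<omega> = y k (T k \<omega>) \<omega>"
    and solve: "\<And>k t. k < K \<Longrightarrow>
          (let A = (\<lambda>\<omega>. vrcs_subproblem f1 g1 \<theta>
                          (vrcs_dir f f1 g g1 p (b k t \<omega>) (x k \<omega>) (y k t \<omega>)) (y k t \<omega>))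
           in (\<integral>\<^sup>+ \<omega>. ennreal ((norm (grad (A \<omega>) (y k (Suc t) \<omega>)))\<^sup>2) \<partial>M)
              \<le> (\<integral>\<^sup>+ \<omega>. ennreal (\<mu> / (17 * \<theta>) *
                            (norm (y k t \<omega> - arg_min (A \<omega>) (\<lambda>_. True)))\<^sup>2) \<partial>M))"

text \<open>Each epoch needs one round of either kind for \<open>\<nabla>h\<close> at its starting point, which also yields
  \<open>\<zeta>\<^sub>t\<close> for every \<open>t\<close>; each step needs one further round, of the kind decided by
  the Bernoulli draw, for \<open>\<xi>\<^sub>t\<close>.\<close>

definition rounds_f :: "nat \<Rightarrow> (nat \<Rightarrow> 'w \<Rightarrow> nat) \<Rightarrow> (nat \<Rightarrow> nat \<Rightarrow> 'w \<Rightarrow> bool) \<Rightarrow> 'w \<Rightarrow> nat" where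
  "rounds_f K T b \<omega> = (\<Sum>k<K. 1 + card {t. t < T k \<omega> \<and> b k t \<omega>})"

definition rounds_g :: "nat \<Rightarrow> (nat \<Rightarrow> 'w \<Rightarrow> nat) \<Rightarrow> (nat \<Rightarrow> nat \<Rightarrow> 'w \<Rightarrow> bool) \<Rightarrow> 'w \<Rightarrow> nat" where
  "rounds_g K T b \<omega> = (\<Sum>k<K. 1 + card {t. t < T k \<omega> \<and> \<not> b k t \<omega>})"

end

theory Submission
  imports Defs
begin

text \<open>
  With the exact direction \<open>\<nabla>(h - h\<^sub>1)(x\<^sub>t)\<close> in place of \<open>e\<^sub>t\<close>, a step of the method would be a
  Bregman proximal step for \<open>h\<close>. The distance that governs it is \<open>\<Psi>\<close>, the Bregman divergence of
  \<open>\<parallel>\<cdot>\<parallel>\<^sup>2 / (2\<theta>) - (h - h\<^sub>1)\<close>. Second-order similarity makes the gradient of \<open>h - h\<^sub>1\<close>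
  \<open>(\<delta>f + \<delta>g)\<close>-Lipschitz and \<open>\<theta>\<close> is so small that \<open>\<theta> (\<delta>f + \<delta>g) \<le> 1/4\<close>; so, although none of
  \<open>f\<close>, \<open>g\<close> and \<open>h\<^sub>1\<close> need be convex, every subproblem is strongly convex and \<open>\<Psi>\<close> is comparable to
  \<open>\<parallel>\<cdot>\<parallel>\<^sup>2 / \<theta>\<close>.

  The lemma \<open>one_step\<close> compares \<open>h (x\<^sub>t\<^sub>+\<^sub>1)\<close> with \<open>h z\<close> for an arbitrary reference point \<open>z\<close>. The price
  of the stochastic direction is a term of mean zero plus \<open>\<theta>\<close> times the variance. As in SVRG the
  variance is at most a multiple of \<open>\<parallel>x\<^sub>t - x\<^sub>0\<parallel>\<^sup>2\<close>, where \<open>x\<^sub>0\<close> is the start of the epoch. The price of the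
  inexact solution is absorbed by \<open>\<parallel>x\<^sub>t\<^sub>+\<^sub>1 - x\<^sub>t\<parallel>\<^sup>2\<close> (\<open>solver_residual_small\<close>).

  A geometric epoch length turns the telescoping differences into
  \<open>E[Z\<^bsub>T-1\<^esub> - Z\<^bsub>T\<^esub>] = q (Z\<^sub>0 - E Z\<^bsub>T\<^esub>)\<close>. With \<open>z = x\<^sub>0\<close> this shows that an epoch does not increase
  \<open>E h\<close>, and that the decrease pays for the accumulated variance. With \<open>z = x\<^sub>*\<close> it produces the gain
  from strong convexity. A combination of the two inequalities
  (\<open>epoch_recursion_contracts\<close>, \<open>epoch_contraction\<close>) says that the potential
  \<open>(1 + \<rho>/5) (h - h(x\<^sub>*)) + \<rho> q \<Psi>(x\<^sub>*, \<cdot>)\<close> contracts by the factor \<open>1 + \<rho>/2\<close> in every epoch,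
  where \<open>\<rho> = 2 \<mu> \<theta> / (5 q)\<close>. The factor \<open>\<rho>\<close> of \<open>q \<Psi>\<close> is what keeps the potential at most
  \<open>2 (h - h(x\<^sub>*))\<close>; a factor of constant order would cost an additional factor \<open>log (\<delta>f / \<mu>)\<close>.

  For the stated parameters \<open>\<rho>\<close> is of order \<open>\<mu> / \<delta>f\<close>, so that \<open>O(\<delta>f / \<mu> log (1/\<epsilon>))\<close> epochs suffice.
  An epoch costs in expectation \<open>1 + p/q = 2\<close> rounds for the nodes of \<open>f\<close> and
  \<open>1 + (1 - p)/q = 1 + \<delta>g\<^sup>2 / \<delta>f\<^sup>2\<close> rounds for those of \<open>g\<close>.
\<close>

section \<open>Gradients\<close>

lemma grad_eqI:
  assumes "GDERIV \<phi> x :> D"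
  shows "grad \<phi> x = D"
  unfolding grad_def
proof (rule the_equality)
  show "GDERIV \<phi> x :> D" by fact
next
  fix D' assume "GDERIV \<phi> x :> D'"
  then have "(\<lambda>h. h \<bullet> D') = (\<lambda>h. h \<bullet> D)"
    using assms has_derivative_unique unfolding gderiv_def by blast
  then have "(D' - D) \<bullet> D' = (D' - D) \<bullet> D" by metis
  then have "(D' - D) \<bullet> (D' - D) = 0" by (simp add: inner_diff_right)
  then show "D' = D" by simp
qed

lemma GDERIV_grad:
  fixes \<phi> :: "'a::euclidean_space \<Rightarrow> real"
  assumes "\<phi> differentiable (at x)"
  shows "GDERIV \<phi> x :> grad \<phi> x"
proof -
  obtain L where L: "(\<phi> has_derivative L) (at x)"
    using assms unfolding differentiable_def by blast
  define D where "D = (\<Sum>i\<in>Basis. L i *\<^sub>R i)"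
  have lin: "linear L" using L has_derivative_linear by blast
  have "L h = h \<bullet> D" for h
  proof -
    have "L h = L (\<Sum>i\<in>Basis. (h \<bullet> i) *\<^sub>R i)" by (simp add: euclidean_representation)
    also have "\<dots> = (\<Sum>i\<in>Basis. (h \<bullet> i) * L i)"
      by (simp add: linear_sum[OF lin] linear_scale[OF lin])
    also have "\<dots> = h \<bullet> D" by (simp add: D_def inner_sum_right mult.commute)
    finally show ?thesis .
  qed
  then have "L = (\<lambda>h. h \<bullet> D)" by auto
  then have "GDERIV \<phi> x :> D" using L by (simp add: gderiv_def)
  then show ?thesis using grad_eqI by metis
qed

lemma grad_add:
  fixes \<phi> \<psi> :: "'a::euclidean_space \<Rightarrow> real"
  assumes "\<phi> differentiable (at x)" "\<psi> differentiable (at x)"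
  shows "grad (\<lambda>z. \<phi> z + \<psi> z) x = grad \<phi> x + grad \<psi> x"
  by (intro grad_eqI GDERIV_add GDERIV_grad assms)

lemma grad_diff:
  fixes \<phi> \<psi> :: "'a::euclidean_space \<Rightarrow> real"
  assumes "\<phi> differentiable (at x)" "\<psi> differentiable (at x)"
  shows "grad (\<lambda>z. \<phi> z - \<psi> z) x = grad \<phi> x - grad \<psi> x"
  by (intro grad_eqI GDERIV_diff GDERIV_grad assms)

lemma grad_eq_0_at_minimum:
  fixes \<phi> :: "'a::euclidean_space \<Rightarrow> real"
  assumes "\<phi> differentiable (at x)" "\<And>z. \<phi> x \<le> \<phi> z"
  shows "grad \<phi> x = 0"
proof -
  have "(\<lambda>h. h \<bullet> grad \<phi> x) = (\<lambda>h. 0)"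
    using GDERIV_grad[OF assms(1)] unfolding gderiv_def
    by (rule has_derivative_local_min) (simp add: assms(2))
  then have "grad \<phi> x \<bullet> grad \<phi> x = 0" by metis
  then show ?thesis by simp
qed

text \<open>
  Restriction to a line reduces the quadratic bounds below to monotonicity of a function of one real
  variable.
\<close>

lemma DERIV_along_line:
  assumes "GDERIV \<phi> (y + t *\<^sub>R d) :> D"
  shows "((\<lambda>t. \<phi> (y + t *\<^sub>R d)) has_real_derivative (d \<bullet> D)) (at t)"
proof -
  have "((\<lambda>t. y + t *\<^sub>R d) has_derivative (\<lambda>s. s *\<^sub>R d)) (at t)"
    by (auto intro!: derivative_eq_intros)
  from diff_chain_at[OF this] assms
  have "((\<lambda>t. \<phi> (y + t *\<^sub>R d)) has_derivative (\<lambda>s. (s *\<^sub>R d) \<bullet> D)) (at t)"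
    unfolding gderiv_def o_def by blast
  then show ?thesis
    unfolding has_field_derivative_def by (simp add: mult_commute_abs)
qed

lemma lipschitz_gradient_upper:
  fixes \<phi> :: "'a::euclidean_space \<Rightarrow> real"
  assumes der: "\<And>x. GDERIV \<phi> x :> G x"
    and lip: "\<And>x y. norm (G x - G y) \<le> L * norm (x - y)"
  shows "\<phi> x - \<phi> y - G y \<bullet> (x - y) \<le> L / 2 * (norm (x - y))\<^sup>2"
proof -
  define d where "d = x - y"
  define u where "u t = \<phi> (y + t *\<^sub>R d) - t * (d \<bullet> G y) - L / 2 * t\<^sup>2 * (norm d)\<^sup>2" for t
  have u': "(u has_real_derivative
      (d \<bullet> G (y + t *\<^sub>R d) - d \<bullet> G y - L * t * (norm d)\<^sup>2)) (at t)" for t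
    unfolding u_def
    by (auto intro!: derivative_eq_intros DERIV_along_line[OF der])
  have "u 1 \<le> u 0"
  proof (rule DERIV_nonpos_imp_nonincreasing[of 0 1 u])
    show "(0::real) \<le> 1" by simp
    fix t :: real assume t: "0 \<le> t" "t \<le> 1"
    have "d \<bullet> G (y + t *\<^sub>R d) - d \<bullet> G y = d \<bullet> (G (y + t *\<^sub>R d) - G y)"
      by (simp add: inner_diff_right)
    also have "\<dots> \<le> norm d * norm (G (y + t *\<^sub>R d) - G y)" by (rule norm_cauchy_schwarz)
    also have "\<dots> \<le> norm d * (L * norm (y + t *\<^sub>R d - y))"
      by (intro mult_left_mono lip) simp
    also have "\<dots> = L * t * (norm d)\<^sup>2" using t by (simp add: power2_eq_square)
    finally show "\<exists>z. DERIV u t :> z \<and> z \<le> 0" using u'[of t] by (intro exI conjI) auto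
  qed
  then show ?thesis by (simp add: u_def d_def inner_commute)
qed

text \<open>
  The hypotheses are invariant under \<open>\<phi> \<mapsto> - \<phi>\<close>, so the upper bound also holds for \<open>- \<phi>\<close>. This
  is what allows \<open>f\<close>, \<open>g\<close> and their differences from the server functions to be non-convex.
\<close>

lemma lipschitz_gradient_bregman:
  fixes \<phi> :: "'a::euclidean_space \<Rightarrow> real"
  assumes der: "\<And>x. GDERIV \<phi> x :> G x"
    and lip: "\<And>x y. norm (G x - G y) \<le> L * norm (x - y)"
  shows "\<bar>\<phi> x - \<phi> y - G y \<bullet> (x - y)\<bar> \<le> L / 2 * (norm (x - y))\<^sup>2"
proof -
  have "GDERIV (\<lambda>x. - \<phi> x) x :> - G x" for x by (intro GDERIV_minus der)
  moreover have "norm (- G x - - G y) \<le> L * norm (x - y)" for x y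
    using lip[of x y] by (simp add: norm_minus_commute)
  ultimately have "- \<phi> x - - \<phi> y - - G y \<bullet> (x - y) \<le> L / 2 * (norm (x - y))\<^sup>2"
    by (rule lipschitz_gradient_upper)
  with lipschitz_gradient_upper[of \<phi> G L x y, OF der lip] show ?thesis
    unfolding abs_le_iff inner_minus_left by linarith
qed

section \<open>Second-order similarity\<close>

text \<open>
  Only the difference of the two functions has a bounded Hessian, so this is the one source of
  smoothness in the analysis.
\<close>

lemma lipschitz_grad_diff:
  fixes \<phi> \<psi> :: "real^'d \<Rightarrow> real"
  assumes "twice_differentiable \<phi>" "twice_differentiable \<psi>"
    and sim: "\<And>x. spectral_norm (hess \<psi> x - hess \<phi> x) \<le> \<delta>"
  shows "norm (grad (\<lambda>z. \<phi> z - \<psi> z) x - grad (\<lambda>z. \<phi> z - \<psi> z) y) \<le> \<delta> * norm (x - y)"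
proof (rule differentiable_bound[OF convex_UNIV])
  have h: "(grad \<phi> has_derivative (*v) (hess \<phi> z)) (at z)"
    "(grad \<psi> has_derivative (*v) (hess \<psi> z)) (at z)" for z
    using assms(1,2) unfolding twice_differentiable_def hess_def jacobian_works[symmetric] by auto
  have eq: "grad (\<lambda>z. \<phi> z - \<psi> z) = (\<lambda>z. grad \<phi> z - grad \<psi> z)"
    using assms(1,2) unfolding twice_differentiable_def by (auto simp: grad_diff)
  show "(grad (\<lambda>z. \<phi> z - \<psi> z) has_derivative (\<lambda>v. hess \<phi> z *v v - hess \<psi> z *v v)) (at z within UNIV)" for z
    unfolding eq by (intro has_derivative_diff h)
  have "(\<lambda>v. hess \<phi> z *v v - hess \<psi> z *v v) = (\<lambda>v. - ((hess \<psi> z - hess \<phi> z) *v v))" for z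
    by (auto simp: matrix_vector_mult_diff_rdistrib)
  then show "onorm (\<lambda>v. hess \<phi> z *v v - hess \<psi> z *v v) \<le> \<delta>" for z
    using sim[of z] unfolding spectral_norm_def by (simp add: onorm_neg)
qed auto

lemma twice_differentiable_average:
  assumes "finite I" "\<And>m. m \<in> I \<Longrightarrow> twice_differentiable (\<phi> m)"
  shows "twice_differentiable (average I \<phi>)"
proof -
  have d: "GDERIV (average I \<phi>) x :> (1 / real (card I)) *\<^sub>R (\<Sum>m\<in>I. grad (\<phi> m) x)" for x
  proof -
    have "((\<lambda>x. \<Sum>m\<in>I. \<phi> m x) has_derivative (\<lambda>v. \<Sum>m\<in>I. v \<bullet> grad (\<phi> m) x)) (at x)"
      using assms(2) GDERIV_grad unfolding twice_differentiable_def gderiv_def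
      by (intro has_derivative_sum) blast
    from has_derivative_mult_right[OF this, of "1 / real (card I)"]
    show ?thesis unfolding gderiv_def average_def[abs_def] by (simp add: inner_sum_right)
  qed
  then have "grad (average I \<phi>) = (\<lambda>x. (1 / real (card I)) *\<^sub>R (\<Sum>m\<in>I. grad (\<phi> m) x))"
    using grad_eqI by blast
  moreover have "(\<lambda>x. (1 / real (card I)) *\<^sub>R (\<Sum>m\<in>I. grad (\<phi> m) x)) differentiable (at x)" for x
    using assms unfolding twice_differentiable_def
    by (intro differentiable_scaleR differentiable_sum differentiable_const) auto
  ultimately show ?thesis
    using d unfolding twice_differentiable_def gderiv_def differentiable_def by auto
qed

section \<open>Elementary inequalities\<close>

lemma le_norm_sum_squares:
  fixes a b :: "'a::real_inner"
  shows "(norm (a + b))\<^sup>2 \<le> 2 * (norm a)\<^sup>2 + 2 * (norm b)\<^sup>2"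
proof -
  have "(norm (a + b))\<^sup>2 + (norm (a - b))\<^sup>2 = 2 * (norm a)\<^sup>2 + 2 * (norm b)\<^sup>2"
    by (simp add: power2_norm_eq_inner algebra_simps inner_commute)
  then show ?thesis by (smt (verit) zero_le_power2)
qed

lemma young_inner:
  fixes a b :: "'a::real_inner"
  assumes "0 < \<alpha>"
  shows "a \<bullet> b \<le> \<alpha> * (norm a)\<^sup>2 + (norm b)\<^sup>2 / (4 * \<alpha>)"
proof -
  have "0 \<le> (norm ((2 * \<alpha>) *\<^sub>R a - b))\<^sup>2" by simp
  also have "\<dots> = 4 * \<alpha>\<^sup>2 * (norm a)\<^sup>2 - 4 * \<alpha> * (a \<bullet> b) + (norm b)\<^sup>2"
    unfolding power2_norm_eq_inner
    by (simp add: algebra_simps inner_commute power2_eq_square)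
  also have "\<dots> = 4 * \<alpha> * (\<alpha> * (norm a)\<^sup>2 + (norm b)\<^sup>2 / (4 * \<alpha>) - a \<bullet> b)"
    using assms by (simp add: field_simps power2_eq_square)
  finally show ?thesis using assms by (simp add: zero_le_mult_iff)
qed

text \<open>
  With \<open>a = \<delta>f\<close> and \<open>b = \<delta>g\<close> the right-hand side bounds the variance of the method, and the smoothness constant of
  \<open>h - h\<^sub>1\<close> is the sum on the left. A step size tuned to the variance is hence automatically small
  compared with that constant.
\<close>

lemma sedrakyan:
  fixes a b p :: real
  assumes "0 < p" "p < 1"
  shows "(a + b)\<^sup>2 \<le> a\<^sup>2 / p + b\<^sup>2 / (1 - p)"
proof -
  have "a\<^sup>2 / p + b\<^sup>2 / (1 - p) - (a + b)\<^sup>2 = ((1 - p) * a - p * b)\<^sup>2 / (p * (1 - p))"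
    using assms by (simp add: field_simps power2_eq_square)
  then show ?thesis using assms by (smt (verit) divide_nonneg_pos mult_pos_pos zero_le_power2)
qed

section \<open>The proximal step\<close>

text \<open>
  The analysis works for all sampling probabilities, epoch parameters and step sizes that satisfy
  \<open>noise_level\<close> and \<open>conditioning\<close>. The first is the step-size rule
  \<open>\<theta>\<^sup>2 \<le> p (1 - p) q / (16 (p \<delta>g\<^sup>2 + (1 - p) \<delta>f\<^sup>2))\<close>, written so that its left-hand side bounds the
  variance of the stochastic direction relative to \<open>\<parallel>x\<^sub>t - x\<^sub>0\<parallel>\<^sup>2\<close>. The second asks for epochs that are not too long compared
  with the time scale \<open>1 / (\<mu> \<theta>)\<close> of the proximal steps.
\<close>

locale vrcs_problem =
  fixes f f1 g g1 :: "real^'d \<Rightarrow> real" and p q \<theta> \<mu> \<delta>f \<delta>g :: real and xs :: "real^'d"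
  assumes twice_diff: "twice_differentiable f" "twice_differentiable f1"
      "twice_differentiable g" "twice_differentiable g1"
    and \<mu>_pos: "0 < \<mu>"
    and convex: "strongly_convex \<mu> (\<lambda>z. f z + g z)"
    and minimizer: "\<And>z. f xs + g xs \<le> f z + g z"
    and lipschitz_f: "\<And>x y. norm (grad (\<lambda>z. f z - f1 z) x - grad (\<lambda>z. f z - f1 z) y) \<le> \<delta>f * norm (x - y)"
    and lipschitz_g: "\<And>x y. norm (grad (\<lambda>z. g z - g1 z) x - grad (\<lambda>z. g z - g1 z) y) \<le> \<delta>g * norm (x - y)"
    and p_pos: "0 < p" and p_less_1: "p < 1" and q_pos: "0 < q" and q_less_1: "q < 1"
    and \<theta>_pos: "0 < \<theta>"
    and noise_level: "\<delta>f\<^sup>2 / p + \<delta>g\<^sup>2 / (1 - p) \<le> q / (16 * \<theta>\<^sup>2)"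
    and conditioning: "\<mu> * \<theta> \<le> q / 5"
begin

abbreviation h :: "real^'d \<Rightarrow> real" where
  "h \<equiv> \<lambda>z. f z + g z"

abbreviation residual_f :: "real^'d \<Rightarrow> real^'d" where
  "residual_f \<equiv> grad (\<lambda>z. f z - f1 z)"

abbreviation residual_g :: "real^'d \<Rightarrow> real^'d" where
  "residual_g \<equiv> grad (\<lambda>z. g z - g1 z)"

text \<open>
  The gradient of \<open>h - h\<^sub>1\<close>, as \<open>residual_f\<close> and \<open>residual_g\<close> are those of \<open>f - f\<^sub>1\<close> and \<open>g - g\<^sub>1\<close>.
\<close>

definition residual :: "real^'d \<Rightarrow> real^'d" where
  "residual z = residual_f z + residual_g z"

text \<open>
  The Bregman divergence \<open>D(z, y)\<close> of \<open>\<parallel>\<cdot>\<parallel>\<^sup>2 / (2\<theta>) - (h - h\<^sub>1)\<close>.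
\<close>

definition \<Psi> :: "real^'d \<Rightarrow> real^'d \<Rightarrow> real" where
  "\<Psi> z y = (norm (z - y))\<^sup>2 / (2 * \<theta>)
     - ((h z - (f1 z + g1 z)) - (h y - (f1 y + g1 y)) - residual y \<bullet> (z - y))"

text \<open>
  The error of \<open>e\<^sub>t\<close> as an estimate of the gradient of \<open>h - h\<^sub>1\<close> at the current point \<open>y\<close>, for an
  epoch that starts at \<open>s\<close>.
\<close>

definition noise :: "bool \<Rightarrow> real^'d \<Rightarrow> real^'d \<Rightarrow> real^'d" where
  "noise b s y = vrcs_dir f f1 g g1 p b s y - residual y"

lemma differentiable: "f differentiable (at x)" "f1 differentiable (at x)"
    "g differentiable (at x)" "g1 differentiable (at x)"
  using twice_diff unfolding twice_differentiable_def by auto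

lemma GDERIV_residual: "GDERIV (\<lambda>z. h z - (f1 z + g1 z)) x :> residual x"
proof -
  have "GDERIV (\<lambda>z. (f z - f1 z) + (g z - g1 z)) x :> residual x"
    unfolding residual_def
    by (intro GDERIV_add GDERIV_grad differentiable_diff differentiable)
  then show ?thesis by (simp add: algebra_simps)
qed

lemma grad_h_eq: "grad h x = grad f1 x + grad g1 x + residual x"
  by (simp add: residual_def grad_add grad_diff differentiable)

lemma grad_h_minimizer: "grad h xs = 0"
  by (intro grad_eq_0_at_minimum differentiable_add differentiable minimizer)

lemma continuous_grad: "continuous_on UNIV (grad f1)" "continuous_on UNIV (grad g1)"
  using twice_diff unfolding twice_differentiable_def
  by (auto intro!: continuous_at_imp_continuous_on differentiable_imp_continuous_within)

lemma continuous_functions: "continuous_on UNIV f" "continuous_on UNIV g"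
   "continuous_on UNIV f1" "continuous_on UNIV g1"
  using differentiable by (auto intro!: continuous_at_imp_continuous_on differentiable_imp_continuous_within)

lemma continuous_residuals: "continuous_on UNIV residual_f" "continuous_on UNIV residual_g"
   "continuous_on UNIV residual"
proof -
  have e: "residual_f = (\<lambda>z. grad f z - grad f1 z)" "residual_g = (\<lambda>z. grad g z - grad g1 z)"
    by (auto simp: grad_diff differentiable)
  show c: "continuous_on UNIV residual_f" "continuous_on UNIV residual_g"
    unfolding e using twice_diff unfolding twice_differentiable_def
    by (auto intro!: continuous_at_imp_continuous_on differentiable_imp_continuous_within)
  show "continuous_on UNIV residual"
    unfolding residual_def[abs_def] by (intro continuous_on_add c)
qed

lemma residual_lipschitz: "norm (residual x - residual y) \<le> (\<delta>f + \<delta>g) * norm (x - y)"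
proof -
  have "norm (residual x - residual y)
      = norm ((residual_f x - residual_f y) + (residual_g x - residual_g y))"
    by (simp add: residual_def algebra_simps)
  also have "\<dots> \<le> \<delta>f * norm (x - y) + \<delta>g * norm (x - y)"
    by (rule norm_triangle_mono[OF lipschitz_f lipschitz_g])
  finally show ?thesis by (simp add: distrib_right)
qed

lemma step_size_small: "(\<delta>f + \<delta>g) * \<theta> \<le> 1 / 4"
proof -
  have "(\<delta>f + \<delta>g)\<^sup>2 \<le> q / (16 * \<theta>\<^sup>2)"
    using sedrakyan[OF p_pos p_less_1] noise_level by (rule order_trans)
  also have "\<dots> \<le> 1 / (16 * \<theta>\<^sup>2)"
    using q_less_1 \<theta>_pos by (intro divide_right_mono) auto
  finally have "((\<delta>f + \<delta>g) * \<theta>)\<^sup>2 \<le> (1 / 4)\<^sup>2"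
    using \<theta>_pos by (simp add: field_simps power2_eq_square)
  then show ?thesis by (rule power2_le_imp_le) simp
qed

lemma residual_bregman:
  "\<bar>(h z - (f1 z + g1 z)) - (h y - (f1 y + g1 y)) - residual y \<bullet> (z - y)\<bar> \<le> (norm (z - y))\<^sup>2 / (8 * \<theta>)"
proof -
  have "\<bar>(h z - (f1 z + g1 z)) - (h y - (f1 y + g1 y)) - residual y \<bullet> (z - y)\<bar>
      \<le> (\<delta>f + \<delta>g) / 2 * (norm (z - y))\<^sup>2"
    by (rule lipschitz_gradient_bregman[OF GDERIV_residual residual_lipschitz])
  also have "\<dots> \<le> 1 / (8 * \<theta>) * (norm (z - y))\<^sup>2"
    using step_size_small \<theta>_pos by (intro mult_right_mono) (auto simp: field_simps)
  finally show ?thesis by simp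
qed

lemma \<Psi>_lower: "3 / (8 * \<theta>) * (norm (z - y))\<^sup>2 \<le> \<Psi> z y"
  and \<Psi>_upper: "\<Psi> z y \<le> 5 / (8 * \<theta>) * (norm (z - y))\<^sup>2"
proof -
  have "(norm (z - y))\<^sup>2 / (2 * \<theta>) = 4 / (8 * \<theta>) * (norm (z - y))\<^sup>2"
    "5 / (8 * \<theta>) * (norm (z - y))\<^sup>2 = 4 / (8 * \<theta>) * (norm (z - y))\<^sup>2 + (norm (z - y))\<^sup>2 / (8 * \<theta>)"
    "3 / (8 * \<theta>) * (norm (z - y))\<^sup>2 = 4 / (8 * \<theta>) * (norm (z - y))\<^sup>2 - (norm (z - y))\<^sup>2 / (8 * \<theta>)"
    using \<theta>_pos by (simp_all add: field_simps)
  then show "3 / (8 * \<theta>) * (norm (z - y))\<^sup>2 \<le> \<Psi> z y" "\<Psi> z y \<le> 5 / (8 * \<theta>) * (norm (z - y))\<^sup>2"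
    using residual_bregman[of z y] unfolding \<Psi>_def by linarith+
qed

lemma \<Psi>_nonneg: "0 \<le> \<Psi> z y"
  using \<Psi>_lower[of z y] \<theta>_pos by (smt (verit) divide_nonneg_pos mult_nonneg_nonneg zero_le_power2)

lemma \<Psi>_self [simp]: "\<Psi> z z = 0"
  by (simp add: \<Psi>_def)

lemma h_strongly_convex: "h z + grad h z \<bullet> (x - z) + \<mu> / 2 * (norm (x - z))\<^sup>2 \<le> h x"
  using convex unfolding strongly_convex_def by blast

lemma h_growth: "\<mu> / 2 * (norm (x - xs))\<^sup>2 \<le> h x - h xs"
  using h_strongly_convex[of xs x] by (simp add: grad_h_minimizer)

subsection \<open>Strong convexity of the subproblem\<close>

abbreviation A :: "real^'d \<Rightarrow> real^'d \<Rightarrow> real^'d \<Rightarrow> real" where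
  "A \<equiv> vrcs_subproblem f1 g1 \<theta>"

lemma GDERIV_subproblem:
  "GDERIV (A e y) w :> e + (1 / \<theta>) *\<^sub>R (w - y) + (grad f1 w + grad g1 w)"
proof -
  have "GDERIV (\<lambda>z. e \<bullet> z) w :> e"
    unfolding gderiv_def by (auto intro!: derivative_eq_intros simp: inner_commute)
  moreover have "GDERIV (\<lambda>z. 1 / (2 * \<theta>) * (norm (z - y))\<^sup>2) w :> (1 / \<theta>) *\<^sub>R (w - y)"
    unfolding gderiv_def power2_norm_eq_inner
    using \<theta>_pos by (auto intro!: derivative_eq_intros simp: inner_commute)
  ultimately show ?thesis
    unfolding vrcs_subproblem_def[abs_def]
    by (intro GDERIV_add GDERIV_grad differentiable)
qed

lemma grad_subproblem: "grad (A e y) w = e + (1 / \<theta>) *\<^sub>R (w - y) + (grad f1 w + grad g1 w)"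
  by (rule grad_eqI[OF GDERIV_subproblem])

text \<open>
  The quadratic term has modulus \<open>1 / \<theta>\<close>. Since \<open>h\<^sub>1 = h - (h - h\<^sub>1)\<close> with \<open>h\<close> convex and \<open>h - h\<^sub>1\<close>
  smooth with constant at most \<open>1 / (4\<theta>)\<close>, adding \<open>h\<^sub>1\<close> costs at most a quarter of it.
\<close>

lemma subproblem_strongly_convex:
  "A e y z + grad (A e y) z \<bullet> (x - z) + 3 / (8 * \<theta>) * (norm (x - z))\<^sup>2 \<le> A e y x"
proof -
  have quad: "1 / (2 * \<theta>) * (norm (x - y))\<^sup>2
      = 1 / (2 * \<theta>) * (norm (z - y))\<^sup>2 + ((1 / \<theta>) *\<^sub>R (z - y)) \<bullet> (x - z)
        + 1 / (2 * \<theta>) * (norm (x - z))\<^sup>2"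
  proof -
    have "(norm (x - y))\<^sup>2 = (norm (z - y))\<^sup>2 + 2 * ((z - y) \<bullet> (x - z)) + (norm (x - z))\<^sup>2"
      by (simp add: power2_norm_eq_inner algebra_simps inner_commute)
    then show ?thesis using \<theta>_pos by (simp only: inner_scaleR_left) (simp add: field_simps)
  qed
  have split: "1 / (2 * \<theta>) * (norm (x - z))\<^sup>2
      = 3 / (8 * \<theta>) * (norm (x - z))\<^sup>2 + (norm (x - z))\<^sup>2 / (8 * \<theta>)"
    using \<theta>_pos by (simp add: field_simps)
  have conv: "h z + grad h z \<bullet> (x - z) \<le> h x"
    using h_strongly_convex[of z x] \<mu>_pos by (smt (verit) mult_nonneg_nonneg zero_le_power2 divide_nonneg_pos)
  have grads: "grad (A e y) z \<bullet> (x - z)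
      = e \<bullet> x - e \<bullet> z + ((1 / \<theta>) *\<^sub>R (z - y)) \<bullet> (x - z)
        + (grad h z \<bullet> (x - z) - residual z \<bullet> (x - z))"
    by (simp add: grad_subproblem grad_h_eq inner_add_left inner_diff_right algebra_simps)
  show ?thesis
    using residual_bregman[of x z] conv grads quad split unfolding vrcs_subproblem_def
    by linarith
qed

text \<open>
  By strong convexity the values outside a ball around \<open>y\<close> exceed the value at \<open>y\<close>, which leaves a
  compact set. The radius is chosen so that the quadratic growth beats the linear term there.
\<close>

lemma subproblem_minimum_exists: "\<exists>x. \<forall>z. A e y x \<le> A e y z"
proof -
  define G where "G = grad (A e y) y"
  define r where "r = (8 * \<theta> / 3) * norm G"
  have r0: "0 \<le> r" using \<theta>_pos by (simp add: r_def)
  have c: "continuous_on (cball y r) (A e y)"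
    using GDERIV_subproblem unfolding gderiv_def
    by (meson continuous_at_imp_continuous_on has_derivative_continuous)
  obtain x where x: "x \<in> cball y r" "\<And>z. z \<in> cball y r \<Longrightarrow> A e y x \<le> A e y z"
    using continuous_attains_inf[OF compact_cball _ c] r0 by (metis cball_eq_empty not_le)
  have "A e y x \<le> A e y z" if "z \<notin> cball y r" for z
  proof -
    have d: "r \<le> norm (z - y)" using that by (simp add: dist_norm norm_minus_commute)
    have "- (G \<bullet> (z - y)) \<le> norm G * norm (z - y)"
      using norm_cauchy_schwarz[of "- G" "z - y"] by simp
    also have "\<dots> = 3 / (8 * \<theta>) * r * norm (z - y)" using \<theta>_pos by (simp add: r_def)
    also have "\<dots> \<le> 3 / (8 * \<theta>) * norm (z - y) * norm (z - y)"
      using d \<theta>_pos by (intro mult_right_mono mult_left_mono) auto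
    finally have "A e y y \<le> A e y z"
      using subproblem_strongly_convex[of e y y z] by (simp add: G_def power2_eq_square)
    moreover have "A e y x \<le> A e y y" using x(2) r0 by simp
    ultimately show ?thesis by simp
  qed
  then show ?thesis using x(2) by blast
qed

lemma subproblem_gradient_expansion:
  "norm (x - z) \<le> (4 * \<theta> / 3) * norm (grad (A e y) x - grad (A e y) z)"
proof -
  let ?D = "grad (A e y) x - grad (A e y) z"
  have "3 / (8 * \<theta>) * (norm (x - z))\<^sup>2 + 3 / (8 * \<theta>) * (norm (x - z))\<^sup>2 \<le> ?D \<bullet> (x - z)"
    using subproblem_strongly_convex[of e y z x] subproblem_strongly_convex[of e y x z]
    by (simp add: norm_minus_commute inner_diff_left inner_diff_right)
  also have "\<dots> \<le> norm ?D * norm (x - z)" by (rule norm_cauchy_schwarz)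
  finally have "norm (x - z) * norm (x - z) \<le> ((4 * \<theta> / 3) * norm ?D) * norm (x - z)"
    using \<theta>_pos by (simp add: field_simps power2_eq_square)
  then show ?thesis
    using \<theta>_pos mult_right_le_imp_le[of "norm (x - z)" "norm (x - z)"]
    by (cases "x = z") auto
qed

text \<open>
  This converts the accuracy condition, which measures the distance of the current point from the
  exact minimizer, into a statement about gradients. It also shows that \<open>arg_min\<close> is attained, without
  which the condition would be about an unspecified point.
\<close>

lemma dist_subproblem_minimizer:
  "norm (z - arg_min (A e y) (\<lambda>_. True)) \<le> (4 * \<theta> / 3) * norm (grad (A e y) z)"
proof -
  let ?x = "arg_min (A e y) (\<lambda>_. True)"
  have "is_arg_min (A e y) (\<lambda>_. True) ?x"
    unfolding arg_min_def
    by (rule someI_ex) (use subproblem_minimum_exists in \<open>auto simp: is_arg_min_linorder\<close>)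
  then have m: "\<And>z. A e y ?x \<le> A e y z" by (simp add: is_arg_min_linorder)
  have "A e y differentiable (at ?x)"
    using GDERIV_subproblem unfolding gderiv_def differentiable_def by blast
  then have "grad (A e y) ?x = 0" using m by (rule grad_eq_0_at_minimum)
  then show ?thesis using subproblem_gradient_expansion[of z ?x e y] by simp
qed

subsection \<open>The stochastic direction\<close>

lemma vrcs_dir_eq:
  "vrcs_dir f f1 g g1 p b s y = (if b then (1 / p) *\<^sub>R (residual_f y - residual_f s)
      else (1 / (1 - p)) *\<^sub>R (residual_g y - residual_g s)) + residual s"
proof -
  have "grad h s - grad (\<lambda>z. f1 z + g1 z) s = residual s"
    by (simp add: grad_add differentiable grad_h_eq[unfolded grad_add[OF differentiable(1,3)]])
  then show ?thesis
    unfolding vrcs_dir_def vrcs_sample_def by (simp add: algebra_simps)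
qed

text \<open>
  The direction is unbiased: the factors \<open>1/p\<close> and \<open>1/(1-p)\<close> compensate for the sampling.
\<close>

lemma noise_mean: "p *\<^sub>R noise True s y + (1 - p) *\<^sub>R noise False s y = 0"
  using p_pos p_less_1
  by (simp add: noise_def vrcs_dir_eq residual_def algebra_simps)

text \<open>
  The variance is at most the second moment of \<open>\<xi>\<^sub>t - \<zeta>\<^sub>t\<close>. That moment is small near the start \<open>s\<close>
  because both terms are taken from the same Lipschitz map.
\<close>

lemma noise_variance:
  "p * (norm (noise True s y))\<^sup>2 + (1 - p) * (norm (noise False s y))\<^sup>2
     \<le> q / (16 * \<theta>\<^sup>2) * (norm (y - s))\<^sup>2"
proof -
  define u where "u = residual_f y - residual_f s"
  define v where "v = residual_g y - residual_g s"
  have n: "noise True s y = (1 / p) *\<^sub>R u - (u + v)"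
    "noise False s y = (1 / (1 - p)) *\<^sub>R v - (u + v)"
    by (simp_all add: noise_def vrcs_dir_eq residual_def u_def v_def)
  have expand: "c * (norm ((1 / c) *\<^sub>R a - w))\<^sup>2 = (norm a)\<^sup>2 / c - 2 * (a \<bullet> w) + c * (norm w)\<^sup>2"
    if "0 < c" for c and a w :: "real^'d"
  proof -
    have "(norm ((1 / c) *\<^sub>R a - w))\<^sup>2 = (norm a)\<^sup>2 / c\<^sup>2 - 2 / c * (a \<bullet> w) + (norm w)\<^sup>2"
      unfolding power2_norm_eq_inner
      by (simp add: inner_diff_left inner_diff_right inner_commute power2_eq_square)
    then show ?thesis using that by (simp add: field_simps power2_eq_square)
  qed
  have "p * (norm (noise True s y))\<^sup>2 = (norm u)\<^sup>2 / p - 2 * (u \<bullet> (u + v)) + p * (norm (u + v))\<^sup>2"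
    unfolding n by (rule expand[OF p_pos])
  moreover have "(1 - p) * (norm (noise False s y))\<^sup>2
      = (norm v)\<^sup>2 / (1 - p) - 2 * (v \<bullet> (u + v)) + (1 - p) * (norm (u + v))\<^sup>2"
    unfolding n using p_less_1 by (intro expand) simp
  moreover have "u \<bullet> (u + v) + v \<bullet> (u + v) = (norm (u + v))\<^sup>2"
    by (simp add: power2_norm_eq_inner inner_add_left)
  moreover have "p * (norm (u + v))\<^sup>2 + (1 - p) * (norm (u + v))\<^sup>2 = (norm (u + v))\<^sup>2"
    by (simp add: algebra_simps)
  ultimately have "p * (norm (noise True s y))\<^sup>2 + (1 - p) * (norm (noise False s y))\<^sup>2
      \<le> (norm u)\<^sup>2 / p + (norm v)\<^sup>2 / (1 - p)"
    using zero_le_power2[of "norm (u + v)"] by linarith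
  also have "\<dots> \<le> (\<delta>f * norm (y - s))\<^sup>2 / p + (\<delta>g * norm (y - s))\<^sup>2 / (1 - p)"
    using lipschitz_f[of y s] lipschitz_g[of y s] p_pos p_less_1
    by (intro add_mono divide_right_mono power_mono) (auto simp: u_def v_def)
  also have "\<dots> = (\<delta>f\<^sup>2 / p + \<delta>g\<^sup>2 / (1 - p)) * (norm (y - s))\<^sup>2"
    by (simp add: power_mult_distrib distrib_right)
  also have "\<dots> \<le> q / (16 * \<theta>\<^sup>2) * (norm (y - s))\<^sup>2"
    by (intro mult_right_mono noise_level) simp
  finally show ?thesis .
qed

lemma noise_bounded:
  "(norm (noise b s y))\<^sup>2 \<le> q / (16 * \<theta>\<^sup>2) / min p (1 - p) * (norm (y - s))\<^sup>2"
proof -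
  have "min p (1 - p) * (norm (noise b s y))\<^sup>2 \<le> (if b then p else 1 - p) * (norm (noise b s y))\<^sup>2"
    by (intro mult_right_mono) auto
  also have "\<dots> \<le> p * (norm (noise True s y))\<^sup>2 + (1 - p) * (norm (noise False s y))\<^sup>2"
    using p_pos p_less_1 by (cases b) auto
  also have "\<dots> \<le> q / (16 * \<theta>\<^sup>2) * (norm (y - s))\<^sup>2" by (rule noise_variance)
  finally have "(norm (noise b s y))\<^sup>2 \<le> (q / (16 * \<theta>\<^sup>2) * (norm (y - s))\<^sup>2) / min p (1 - p)"
    using p_pos p_less_1 by (subst pos_le_divide_eq) (auto simp: mult.commute)
  then show ?thesis by simp
qed

text \<open>
  The gradient of \<open>h\<close> need not be Lipschitz, so the size of a step cannot be bounded by means of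
  \<open>\<nabla>h(y)\<close>. At \<open>x\<^sub>*\<close>, however, \<open>\<nabla>h\<^sub>1\<close> equals \<open>- \<nabla>(h - h\<^sub>1)\<close>, and all that remains are Lipschitz terms.
  This bound gives the iterates finite second moments.
\<close>

lemma subproblem_gradient_at_minimizer:
  "\<exists>C\<ge>0. \<forall>b s y. (norm (grad (A (vrcs_dir f f1 g g1 p b s y) y) xs))\<^sup>2
      \<le> C * ((norm (y - xs))\<^sup>2 + (norm (s - xs))\<^sup>2)"
proof -
  define N where "N = q / (16 * \<theta>\<^sup>2) / min p (1 - p)"
  define L where "L = \<delta>f + \<delta>g"
  define C where "C = 2 * (4 * N + 4 * L\<^sup>2) + 2 / \<theta>\<^sup>2 + 4 * N"
  have N0: "0 \<le> N" using q_pos p_pos p_less_1 by (simp add: N_def)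
  have "(norm (grad (A (vrcs_dir f f1 g g1 p b s y) y) xs))\<^sup>2
      \<le> C * ((norm (y - xs))\<^sup>2 + (norm (s - xs))\<^sup>2)" for b s y
  proof -
    have "grad (A (vrcs_dir f f1 g g1 p b s y) y) xs
        = (noise b s y + (residual y - residual xs)) + (1 / \<theta>) *\<^sub>R (xs - y)"
      using grad_h_minimizer by (simp add: noise_def grad_subproblem grad_h_eq algebra_simps eq_neg_iff_add_eq_0)
    then have "(norm (grad (A (vrcs_dir f f1 g g1 p b s y) y) xs))\<^sup>2
        \<le> 2 * (norm (noise b s y + (residual y - residual xs)))\<^sup>2
          + 2 * (norm ((1 / \<theta>) *\<^sub>R (xs - y)))\<^sup>2"
      using le_norm_sum_squares by metis
    also have "(norm ((1 / \<theta>) *\<^sub>R (xs - y)))\<^sup>2 = (1 / \<theta>\<^sup>2) * (norm (y - xs))\<^sup>2"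
      by (simp add: power_mult_distrib norm_minus_commute power_divide)
    also have "(norm (noise b s y + (residual y - residual xs)))\<^sup>2
        \<le> 2 * (norm (noise b s y))\<^sup>2 + 2 * (norm (residual y - residual xs))\<^sup>2"
      by (rule le_norm_sum_squares)
    also have "(norm (residual y - residual xs))\<^sup>2 \<le> (L * norm (y - xs))\<^sup>2"
      unfolding L_def by (intro power_mono residual_lipschitz) simp
    also have "(norm (noise b s y))\<^sup>2 \<le> N * (norm (y - s))\<^sup>2"
      unfolding N_def by (rule noise_bounded)
    also have "(norm (y - s))\<^sup>2 \<le> 2 * (norm (y - xs))\<^sup>2 + 2 * (norm (s - xs))\<^sup>2"
      using le_norm_sum_squares[of "y - xs" "xs - s"] by (simp add: norm_minus_commute)
    finally have "(norm (grad (A (vrcs_dir f f1 g g1 p b s y) y) xs))\<^sup>2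
        \<le> 2 * (2 * (N * (2 * (norm (y - xs))\<^sup>2 + 2 * (norm (s - xs))\<^sup>2)) + 2 * (L * norm (y - xs))\<^sup>2)
          + 2 * (1 / \<theta>\<^sup>2 * (norm (y - xs))\<^sup>2)"
      using N0 by (simp add: mult_left_mono)
    also have "\<dots> \<le> C * ((norm (y - xs))\<^sup>2 + (norm (s - xs))\<^sup>2)"
      using N0 \<theta>_pos unfolding C_def power_mult_distrib
      by (simp add: algebra_simps)
    finally show ?thesis .
  qed
  moreover have "0 \<le> C" using N0 by (simp add: C_def)
  ultimately show ?thesis by blast
qed

text \<open>
  Strong convexity of \<open>h\<close> at the new point \<open>w\<close>, with \<open>\<nabla>h(w)\<close> expressed through the residual \<open>r\<close> of
  the subproblem, reduces everything to the three-point identity for \<open>\<Psi>\<close>. Young's inequality then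
  removes the two error terms: the residual takes half of the strong convexity, and the noise takes
  two thirds of the lower bound \<open>3 / (8\<theta>) \<parallel>w - y\<parallel>\<^sup>2\<close> of \<open>\<Psi> w y\<close>. Only \<open>n \<bullet> (z - y)\<close> is
  left of the noise to first order; it does not involve \<open>w\<close>, hence has mean zero.
\<close>

lemma one_step:
  fixes b s y w z
  defines "r \<equiv> grad (A (vrcs_dir f f1 g g1 p b s y) y) w"
  shows "h w - h z \<le> \<Psi> z y - \<Psi> z w - \<mu> / 4 * (norm (z - w))\<^sup>2
     + ((norm r)\<^sup>2 / \<mu> - (norm (w - y))\<^sup>2 / (8 * \<theta>))
     + noise b s y \<bullet> (z - y) + \<theta> * (norm (noise b s y))\<^sup>2"
proof -
  define n where "n = noise b s y"
  have r: "r = n + residual y + (1 / \<theta>) *\<^sub>R (w - y) + (grad f1 w + grad g1 w)"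
    by (simp add: r_def n_def noise_def grad_subproblem)
  have gh: "grad h w \<bullet> (z - w) = r \<bullet> (z - w) - n \<bullet> (z - y) + n \<bullet> (w - y)
      - (1 / \<theta>) * ((w - y) \<bullet> (z - w)) + residual w \<bullet> (z - w) - residual y \<bullet> (z - w)"
    unfolding grad_h_eq r by (simp add: inner_add_left inner_diff_right algebra_simps)
  have three: "(1 / \<theta>) * ((w - y) \<bullet> (z - w))
      = (norm (z - y))\<^sup>2 / (2 * \<theta>) - (norm (z - w))\<^sup>2 / (2 * \<theta>) - (norm (w - y))\<^sup>2 / (2 * \<theta>)"
  proof -
    have "2 * ((w - y) \<bullet> (z - w)) = (norm (z - y))\<^sup>2 - (norm (z - w))\<^sup>2 - (norm (w - y))\<^sup>2"
      by (simp add: power2_norm_eq_inner algebra_simps inner_commute)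
    moreover have "(1 / \<theta>) * ((w - y) \<bullet> (z - w)) = 2 * ((w - y) \<bullet> (z - w)) / (2 * \<theta>)"
      by simp
    ultimately show ?thesis by (simp add: diff_divide_distrib)
  qed
  have \<Psi>s: "\<Psi> z w + \<Psi> w y - \<Psi> z y
      = - (1 / \<theta>) * ((w - y) \<bullet> (z - w)) + residual w \<bullet> (z - w) - residual y \<bullet> (z - w)"
    using three unfolding \<Psi>_def by (simp add: inner_diff_right)
  have yr: "- (r \<bullet> (z - w)) \<le> (norm r)\<^sup>2 / \<mu> + \<mu> / 4 * (norm (z - w))\<^sup>2"
    using young_inner[of "1 / \<mu>" "- r" "z - w"] \<mu>_pos by (simp add: field_simps)
  have yn: "- (n \<bullet> (w - y)) \<le> \<theta> * (norm n)\<^sup>2 + (norm (w - y))\<^sup>2 / (4 * \<theta>)"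
    using young_inner[of \<theta> "- n" "w - y"] \<theta>_pos by simp
  have split: "3 / (8 * \<theta>) * (norm (w - y))\<^sup>2 = (norm (w - y))\<^sup>2 / (4 * \<theta>) + (norm (w - y))\<^sup>2 / (8 * \<theta>)"
    using \<theta>_pos by (simp add: field_simps)
  show ?thesis
    using h_strongly_convex[of w z] gh \<Psi>s yr yn split \<Psi>_lower[of w y]
    unfolding n_def[symmetric] by (simp add: algebra_simps)
qed

end

section \<open>Averaging over a geometric number of steps\<close>

text \<open>
  Summation by parts against the geometric weights \<open>w\<^sub>j = q (1 - q)\<^sup>j\<close>, which satisfy
  \<open>w\<^sub>j - w\<^bsub>j+1\<^esub> = q w\<^sub>j\<close>. The sum is truncated at \<open>n\<close> because nothing is known
  beforehand about the growth of the sequences; the boundary term on the left is later dropped because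
  it is nonnegative.
\<close>

lemma geometric_weighted_telescope:
  fixes a z d :: "nat \<Rightarrow> real"
  assumes "0 \<le> q" "q \<le> 1" and step: "\<And>t. a (Suc t) + z (Suc t) \<le> z t + C * d t"
  shows "(\<Sum>j<n. q * (1 - q) ^ j * (a (Suc j) + q * z (Suc j) - (1 - q) * C * d (Suc j)))
    + q * (1 - q) ^ n * (z n + C * d n) \<le> q * (z 0 + C * d 0)"
proof (induction n)
  case (Suc n)
  have "0 \<le> q * (1 - q) ^ n" using assms(1,2) by simp
  then have "q * (1 - q) ^ n * (a (Suc n) + z (Suc n)) \<le> q * (1 - q) ^ n * (z n + C * d n)"
    using step by (intro mult_left_mono)
  with Suc.IH show ?case by (simp add: algebra_simps)
qed simp

lemma sum_geometric_weights_le_1: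
  fixes q :: real
  assumes "0 \<le> q" "q \<le> 1"
  shows "(\<Sum>j<n. q * (1 - q) ^ j) \<le> 1"
proof -
  have "(\<Sum>j<n. q * (1 - q) ^ j) = 1 - (1 - q) ^ n"
    by (induction n) (simp_all add: algebra_simps)
  then show ?thesis using assms by simp
qed

lemma sum_geometric_weights_mean:
  fixes q :: real
  assumes "0 < q" "q \<le> 1"
  shows "(\<Sum>j<n. q * (1 - q) ^ j * real (Suc j)) \<le> 1 / q"
proof -
  have "(\<Sum>j<n. q * (1 - q) ^ j * real (Suc j)) = 1 / q - (1 - q) ^ n * (real n + 1 / q)"
    using assms by (induction n) (simp_all add: field_simps)
  then show ?thesis using assms by simp
qed

text \<open>
  The recursion of one epoch, for the expectations at the inner steps: \<open>H\<close> is the gap in \<open>h\<close>,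
  \<open>P\<close> and \<open>Q\<close> are the values of \<open>\<Psi>\<close> relative to \<open>x\<^sub>*\<close> and to the start of the epoch, \<open>N\<close> and \<open>d\<close> the
  corresponding squared distances. The comparison with the start, which controls \<open>d\<close>, gets weight
  \<open>1 + \<rho>/5\<close>, and the comparison with \<open>x\<^sub>*\<close>, which accumulates \<open>d\<close>, gets weight \<open>\<rho>\<close>. Since \<open>6 c d \<le> q Q\<close>,
  a share \<open>\<rho>/5\<close> of the first comparison suffices to cancel the \<open>d\<close> of the second.
\<close>

lemma epoch_recursion_contracts:
  fixes H P Q N d :: "nat \<Rightarrow> real"
  assumes q: "0 < q" "q < 1" and \<rho>: "0 \<le> \<rho>" "\<rho> \<le> 1" and c: "0 \<le> c"
    and from_start: "\<And>t. H (Suc t) - H 0 \<le> Q t - Q (Suc t) + c * d t"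
    and from_minimizer: "\<And>t. H (Suc t) \<le> P t - P (Suc t) - m * N (Suc t) + c * d t"
    and NP: "\<And>t. \<rho> * q * P t \<le> m * N t"
    and dQ: "\<And>t. 6 * c * d t \<le> q * Q t"
    and nonneg: "\<And>t. 0 \<le> H t" "\<And>t. 0 \<le> P t" "\<And>t. 0 \<le> d t"
    and start: "Q 0 = 0" "d 0 = 0"
  shows "(1 + \<rho> / 2) * (\<Sum>j<n. q * (1 - q) ^ j * ((1 + \<rho> / 5) * H (Suc j) + \<rho> * q * P (Suc j)))
    \<le> (1 + \<rho> / 5) * H 0 + \<rho> * q * P 0"
proof -
  define a where "a t = (1 + \<rho> / 5) * (H t - H 0) + \<rho> * (H t + m * N t)" for t
  define z where "z t = (1 + \<rho> / 5) * Q t + \<rho> * P t" for t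
  define C where "C = (1 + 6 * \<rho> / 5) * c"
  have dc: "0 \<le> c * d t" for t using c nonneg(3) by simp
  have Q0: "0 \<le> Q t" for t
  proof -
    have "0 \<le> q * Q t" using dQ[of t] dc[of t] by linarith
    then show ?thesis using q by (simp add: zero_le_mult_iff)
  qed
  have step: "a (Suc t) + z (Suc t) \<le> z t + C * d t" for t
  proof -
    have "(1 + \<rho> / 5) * (H (Suc t) - H 0) \<le> (1 + \<rho> / 5) * (Q t - Q (Suc t) + c * d t)"
      using from_start \<rho> by (intro mult_left_mono) auto
    moreover have "\<rho> * H (Suc t) \<le> \<rho> * (P t - P (Suc t) - m * N (Suc t) + c * d t)"
      using from_minimizer \<rho> by (intro mult_left_mono) auto
    ultimately show ?thesis unfolding a_def z_def C_def by (simp add: algebra_simps)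
  qed
  \<comment> \<open>The weighted contribution of a single step; the strong convexity term \<open>m N\<close> supplies the extra \<open>\<rho>\<close> in front of \<open>P\<close>.\<close>
  have summand: "(1 + \<rho> / 2) * ((1 + \<rho> / 5) * H t + \<rho> * q * P t) - (1 + \<rho> / 5) * H 0
      \<le> a t + q * z t - (1 - q) * C * d t" for t
  proof -
    have 1: "\<rho> * (\<rho> * q * P t) \<le> \<rho> * (m * N t)"
      using NP \<rho> by (intro mult_left_mono)
    have 2: "(1 + \<rho> / 5) * (6 * c * d t) \<le> (1 + \<rho> / 5) * (q * Q t)"
      using dQ \<rho> by (intro mult_left_mono) auto
    have "(1 - q) * C * d t \<le> 1 * C * d t"
      unfolding C_def using q c \<rho> nonneg(3) by (intro mult_right_mono) auto
    then have 3: "(1 - q) * C * d t \<le> (1 + \<rho> / 5) * (6 * c * d t)"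
      using dc[of t] \<rho> by (simp add: C_def algebra_simps)
    have "\<rho> * \<rho> \<le> \<rho>" using \<rho> by (simp add: mult_left_le)
    then have "(1 + \<rho> / 2) * (1 + \<rho> / 5) \<le> 1 + \<rho> / 5 + \<rho>"
      using \<rho> by (simp add: algebra_simps)
    then have 4: "(1 + \<rho> / 2) * (1 + \<rho> / 5) * H t \<le> (1 + \<rho> / 5 + \<rho>) * H t"
      by (rule mult_right_mono) (rule nonneg)
    have 5: "(1 + \<rho> / 2) * (\<rho> * q * P t) \<le> (1 + \<rho>) * (\<rho> * q * P t)"
      using \<rho> q nonneg(2)[of t] by (intro mult_right_mono) auto
    have "(1 + \<rho> / 2) * ((1 + \<rho> / 5) * H t + \<rho> * q * P t)
        = (1 + \<rho> / 2) * (1 + \<rho> / 5) * H t + (1 + \<rho> / 2) * (\<rho> * q * P t)"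
      by (simp add: distrib_left)
    moreover have "a t + q * z t = (1 + \<rho> / 5 + \<rho>) * H t - (1 + \<rho> / 5) * H 0
        + \<rho> * (m * N t) + (1 + \<rho> / 5) * (q * Q t) + \<rho> * q * P t"
      unfolding a_def z_def by (simp add: field_simps)
    moreover have "(1 + \<rho>) * (\<rho> * q * P t) = \<rho> * q * P t + \<rho> * (\<rho> * q * P t)"
      by (simp add: distrib_right)
    ultimately show ?thesis using 1 2 3 4 5 by linarith
  qed
  let ?w = "\<lambda>j. q * (1 - q) ^ j"
  have w0: "0 \<le> ?w j" for j using q by simp
  have rest: "0 \<le> ?w n * (z n + C * d n)"
    using q Q0 nonneg \<rho> c unfolding z_def C_def by (intro mult_nonneg_nonneg add_nonneg_nonneg) auto
  have split: "(\<Sum>j<n. ?w j * (k * X j - B)) = k * (\<Sum>j<n. ?w j * X j) - (\<Sum>j<n. ?w j) * B"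
    for k B :: real and X
  proof -
    have "?w j * (k * X j - B) = k * (?w j * X j) - ?w j * B" for j
      by (simp add: right_diff_distrib)
    then show ?thesis by (simp add: sum_subtractf sum_distrib_left sum_distrib_right)
  qed
  have "(\<Sum>j<n. ?w j * ((1 + \<rho> / 2) * ((1 + \<rho> / 5) * H (Suc j) + \<rho> * q * P (Suc j)) - (1 + \<rho> / 5) * H 0))
      \<le> (\<Sum>j<n. ?w j * (a (Suc j) + q * z (Suc j) - (1 - q) * C * d (Suc j)))"
    by (intro sum_mono mult_left_mono summand w0)
  also have "\<dots> \<le> q * (z 0 + C * d 0)"
    using geometric_weighted_telescope[of q a z C d n, OF _ _ step] q rest by linarith
  also have "\<dots> = \<rho> * q * P 0" by (simp add: z_def start)
  finally have "(1 + \<rho> / 2) * (\<Sum>j<n. ?w j * ((1 + \<rho> / 5) * H (Suc j) + \<rho> * q * P (Suc j)))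
      - (\<Sum>j<n. ?w j) * ((1 + \<rho> / 5) * H 0) \<le> \<rho> * q * P 0"
    unfolding split .
  moreover have "(\<Sum>j<n. ?w j) * ((1 + \<rho> / 5) * H 0) \<le> 1 * ((1 + \<rho> / 5) * H 0)"
    using sum_geometric_weights_le_1[of q n] q \<rho> nonneg(1)[of 0]
    by (intro mult_right_mono) auto
  ultimately show ?thesis by linarith
qed

section \<open>Independent draws\<close>

context prob_space
begin

text \<open>
  In what follows independence is that of a draw from a \<open>\<sigma>\<close>-algebra of past information. It is only
  used in the form that the draw factors out of expectations of quantities determined by the past.
\<close>

lemma
  fixes Z :: "'a \<Rightarrow> real" and X :: "'a \<Rightarrow> 'c"
  assumes F: "subalgebra M F"
    and indep: "indep_set (sets F) (sets (vimage_algebra (space M) X (count_space UNIV)))"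
    and X: "X \<in> measurable M (count_space UNIV)"
    and Z: "Z \<in> borel_measurable F" "integrable M Z"
  shows integrable_mult_indep_indicator: "integrable M (\<lambda>\<omega>. Z \<omega> * indicator S (X \<omega>))"
    and expectation_mult_indep_indicator:
      "expectation (\<lambda>\<omega>. Z \<omega> * indicator S (X \<omega>)) = expectation Z * prob {\<omega> \<in> space M. X \<omega> \<in> S}"
proof -
  let ?I = "\<lambda>\<omega>. indicator S (X \<omega>) :: real"
  have I: "?I \<in> borel_measurable M"
    by (rule measurable_compose[OF X]) simp
  have "sigma_sets (space M) {Z -` A \<inter> space M | A. A \<in> sets borel} \<subseteq> sets F"
    using measurable_sets[OF Z(1)] F sets.top[of F] unfolding subalgebra_def
    by (intro sets.sigma_sets_subset') auto
  moreover have "sigma_sets (space M) {?I -` A \<inter> space M | A. A \<in> sets borel}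
      \<subseteq> sets (vimage_algebra (space M) X (count_space UNIV))"
  proof (rule sets.sigma_sets_subset')
    have "X \<in> measurable (vimage_algebra (space M) X (count_space UNIV)) (count_space UNIV)"
      by (rule measurable_vimage_algebra1) simp
    then have "?I \<in> borel_measurable (vimage_algebra (space M) X (count_space UNIV))"
      by (rule measurable_compose) simp
    from measurable_sets[OF this]
    show "{?I -` A \<inter> space M | A. A \<in> sets borel} \<subseteq> sets (vimage_algebra (space M) X (count_space UNIV))"
      by auto
    show "space M \<in> sets (vimage_algebra (space M) X (count_space UNIV))"
      using sets.top[of "vimage_algebra (space M) X (count_space UNIV)"] by simp
  qed
  ultimately have "indep_set (sigma_sets (space M) {Z -` A \<inter> space M | A. A \<in> sets borel})
      (sigma_sets (space M) {?I -` A \<inter> space M | A. A \<in> sets borel})"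
    using indep unfolding indep_sets2_eq by blast
  then have iv: "indep_var borel Z borel ?I"
    unfolding indep_var_eq using Z(2) I by auto
  have II: "integrable M ?I"
    by (rule integrable_const_bound[where B = 1]) (use I in \<open>auto simp: indicator_def\<close>)
  show "integrable M (\<lambda>\<omega>. Z \<omega> * ?I \<omega>)" by (rule indep_var_integrable[OF iv Z(2) II])
  have "expectation ?I = expectation (indicator {\<omega> \<in> space M. X \<omega> \<in> S})"
    by (rule Bochner_Integration.integral_cong) (auto simp: indicator_def)
  also have "\<dots> = prob {\<omega> \<in> space M. X \<omega> \<in> S}"
    by (simp add: Int_def Collect_conj_eq[symmetric] conj_commute)
  finally show "expectation (\<lambda>\<omega>. Z \<omega> * ?I \<omega>) = expectation Z * prob {\<omega> \<in> space M. X \<omega> \<in> S}"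
    using indep_var_lebesgue_integral[OF iv Z(2) II] by simp
qed

lemma prob_eq_pmf:
  assumes "X \<in> measurable M (count_space UNIV)" "distr M (count_space UNIV) X = measure_pmf D"
  shows "prob {\<omega> \<in> space M. X \<omega> \<in> {c}} = pmf D c"
proof -
  have "pmf D c = measure (distr M (count_space UNIV) X) {c}"
    by (simp add: assms(2) measure_pmf_single)
  also have "\<dots> = prob {\<omega> \<in> space M. X \<omega> \<in> {c}}"
    using assms(1) by (subst measure_distr) (auto simp: vimage_def Int_def conj_commute)
  finally show ?thesis by simp
qed

lemma
  fixes U V :: "'a \<Rightarrow> real" and b :: "'a \<Rightarrow> bool"
  assumes F: "subalgebra M F"
    and indep: "indep_set (sets F) (sets (vimage_algebra (space M) b (count_space UNIV)))"
    and b: "b \<in> measurable M (count_space UNIV)"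
      "distr M (count_space UNIV) b = measure_pmf (bernoulli_pmf p)"
    and p: "0 \<le> p" "p \<le> 1"
    and U: "U \<in> borel_measurable F" "integrable M U"
    and V: "V \<in> borel_measurable F" "integrable M V"
  shows integrable_indep_bernoulli: "integrable M (\<lambda>\<omega>. if b \<omega> then U \<omega> else V \<omega>)"
    and expectation_indep_bernoulli:
      "expectation (\<lambda>\<omega>. if b \<omega> then U \<omega> else V \<omega>) = p * expectation U + (1 - p) * expectation V"
proof -
  have eq: "(\<lambda>\<omega>. if b \<omega> then U \<omega> else V \<omega>)
      = (\<lambda>\<omega>. U \<omega> * indicator {True} (b \<omega>) + V \<omega> * indicator {False} (b \<omega>))"
    by (auto simp: indicator_def)
  note iU = integrable_mult_indep_indicator[OF F indep b(1) U, of "{True}"]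
  note iV = integrable_mult_indep_indicator[OF F indep b(1) V, of "{False}"]
  show "integrable M (\<lambda>\<omega>. if b \<omega> then U \<omega> else V \<omega>)"
    unfolding eq by (intro Bochner_Integration.integrable_add iU iV)
  show "expectation (\<lambda>\<omega>. if b \<omega> then U \<omega> else V \<omega>) = p * expectation U + (1 - p) * expectation V"
    unfolding eq Bochner_Integration.integral_add[OF iU iV]
      expectation_mult_indep_indicator[OF F indep b(1) U]
      expectation_mult_indep_indicator[OF F indep b(1) V] prob_eq_pmf[OF b]
    using p by simp
qed

text \<open>
  The truncated sums of the hypothesis are exactly what \<open>geometric_weighted_telescope\<close> bounds, so
  integrability at the random time follows from estimates at fixed times. The index is shifted
  because the epoch length is at least one.
\<close>

lemma
  fixes G :: "nat \<Rightarrow> 'a \<Rightarrow> real" and T :: "'a \<Rightarrow> nat"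
  assumes F: "\<And>t. subalgebra M (F t)"
    and indep: "\<And>t. indep_set (sets (F t)) (sets (vimage_algebra (space M) T (count_space UNIV)))"
    and T: "T \<in> measurable M (count_space UNIV)"
      "distr M (count_space UNIV) T = measure_pmf (map_pmf Suc (geometric_pmf q))"
    and q: "0 < q" "q \<le> 1"
    and G: "\<And>t. G t \<in> borel_measurable (F t)" "\<And>t. integrable M (G t)" "\<And>t \<omega>. 0 \<le> G t \<omega>"
    and bound: "\<And>n. (\<Sum>j<n. q * (1 - q) ^ j * expectation (G (Suc j))) \<le> B"
  shows integrable_at_geometric_time: "integrable M (\<lambda>\<omega>. G (T \<omega>) \<omega>)"
    and expectation_at_geometric_time: "expectation (\<lambda>\<omega>. G (T \<omega>) \<omega>) \<le> B"
proof -
  have GM: "G t \<in> borel_measurable M" for t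
    using measurable_from_subalg[OF F G(1)] .
  have meas: "(\<lambda>\<omega>. G (T \<omega>) \<omega>) \<in> borel_measurable M"
    by (rule measurable_compose_countable[OF GM T(1)])
  have pT: "prob {\<omega> \<in> space M. T \<omega> \<in> {j}} = (case j of 0 \<Rightarrow> 0 | Suc i \<Rightarrow> q * (1 - q) ^ i)" for j
  proof (cases j)
    case 0
    then show ?thesis unfolding prob_eq_pmf[OF T] by (simp add: pmf_eq_0_set_pmf)
  next
    case (Suc i)
    then show ?thesis unfolding prob_eq_pmf[OF T] using q by (simp add: pmf_map_inj' mult.commute)
  qed
  have "(\<integral>\<^sup>+\<omega>. ennreal (G (T \<omega>) \<omega>) \<partial>M) = (\<integral>\<^sup>+\<omega>. (\<Sum>j. ennreal (G j \<omega> * indicator {j} (T \<omega>))) \<partial>M)"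
  proof (rule nn_integral_cong)
    fix \<omega>
    have "(\<Sum>j. ennreal (G j \<omega> * indicator {j} (T \<omega>))) = (\<Sum>j\<in>{T \<omega>}. ennreal (G j \<omega> * indicator {j} (T \<omega>)))"
      by (rule suminf_finite) auto
    then show "ennreal (G (T \<omega>) \<omega>) = (\<Sum>j. ennreal (G j \<omega> * indicator {j} (T \<omega>)))" by simp
  qed
  also have "\<dots> = (\<Sum>j. \<integral>\<^sup>+\<omega>. ennreal (G j \<omega> * indicator {j} (T \<omega>)) \<partial>M)"
    by (rule nn_integral_suminf)
       (use integrable_mult_indep_indicator[OF F indep T(1) G(1,2)] in auto)
  also have "\<dots> = (\<Sum>j. ennreal (expectation (G j) * prob {\<omega> \<in> space M. T \<omega> \<in> {j}}))"
  proof (rule arg_cong[where f = suminf], rule ext)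
    fix j
    have "(\<integral>\<^sup>+\<omega>. ennreal (G j \<omega> * indicator {j} (T \<omega>)) \<partial>M)
        = ennreal (expectation (\<lambda>\<omega>. G j \<omega> * indicator {j} (T \<omega>)))"
      by (rule nn_integral_eq_integral[OF integrable_mult_indep_indicator[OF F indep T(1) G(1,2)]])
         (auto simp: G(3))
    then show "(\<integral>\<^sup>+\<omega>. ennreal (G j \<omega> * indicator {j} (T \<omega>)) \<partial>M)
        = ennreal (expectation (G j) * prob {\<omega> \<in> space M. T \<omega> \<in> {j}})"
      unfolding expectation_mult_indep_indicator[OF F indep T(1) G(1,2)] .
  qed
  also have "\<dots> \<le> ennreal B"
  proof (rule suminf_le_const)
    fix n
    have nn: "0 \<le> expectation (G j) * prob {\<omega> \<in> space M. T \<omega> \<in> {j}}" for j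
      by (intro mult_nonneg_nonneg Bochner_Integration.integral_nonneg G(3)) simp
    have "(\<Sum>j<n. ennreal (expectation (G j) * prob {\<omega> \<in> space M. T \<omega> \<in> {j}}))
        \<le> (\<Sum>j<Suc n. ennreal (expectation (G j) * prob {\<omega> \<in> space M. T \<omega> \<in> {j}}))"
      by simp
    also have "\<dots> = ennreal (\<Sum>j<Suc n. expectation (G j) * prob {\<omega> \<in> space M. T \<omega> \<in> {j}})"
      by (rule sum_ennreal) (rule nn)
    also have "\<dots> = ennreal (\<Sum>j<n. q * (1 - q) ^ j * expectation (G (Suc j)))"
      unfolding sum.lessThan_Suc_shift pT by (simp add: mult.commute)
    also have "\<dots> \<le> ennreal B" by (rule ennreal_leI[OF bound])
    finally show "(\<Sum>j<n. ennreal (expectation (G j) * prob {\<omega> \<in> space M. T \<omega> \<in> {j}})) \<le> ennreal B" .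
  qed (rule summableI)
  finally have le: "(\<integral>\<^sup>+\<omega>. ennreal (G (T \<omega>) \<omega>) \<partial>M) \<le> ennreal B" .
  show int: "integrable M (\<lambda>\<omega>. G (T \<omega>) \<omega>)"
    by (rule integrableI_nonneg[OF meas]) (use le G(3) in \<open>auto simp: le_less_trans\<close>)
  have "ennreal (expectation (\<lambda>\<omega>. G (T \<omega>) \<omega>)) \<le> ennreal B"
    using le by (subst nn_integral_eq_integral[OF int, symmetric]) (auto simp: G(3))
  moreover have "0 \<le> B" using bound[of 0] by simp
  ultimately show "expectation (\<lambda>\<omega>. G (T \<omega>) \<omega>) \<le> B" by simp
qed

end

section \<open>One epoch\<close>

locale vrcs_analysis =
  vrcs_problem f f1 g g1 p q \<theta> \<mu> \<delta>f \<delta>g xs + vrcs_run M K f f1 g g1 p q \<theta> \<mu> x0 F T b x y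
  for f f1 g g1 :: "real^'d \<Rightarrow> real" and p q \<theta> \<mu> \<delta>f \<delta>g :: real and xs :: "real^'d"
    and M :: "'w measure" and K :: nat and x0 :: "real^'d"
    and F :: "nat \<Rightarrow> nat \<Rightarrow> 'w measure"
    and T :: "nat \<Rightarrow> 'w \<Rightarrow> nat"
    and b :: "nat \<Rightarrow> nat \<Rightarrow> 'w \<Rightarrow> bool"
    and x :: "nat \<Rightarrow> 'w \<Rightarrow> real^'d"
    and y :: "nat \<Rightarrow> nat \<Rightarrow> 'w \<Rightarrow> real^'d"
begin

text \<open>
  Centering at \<open>x\<^sub>*\<close> makes no difference on a probability space and fits the potential.
\<close>

definition square_integrable :: "('w \<Rightarrow> real^'d) \<Rightarrow> bool" where
  "square_integrable u \<longleftrightarrow>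
     u \<in> borel_measurable M \<and> integrable M (\<lambda>\<omega>. (norm (u \<omega> - xs))\<^sup>2)"

lemma square_integrable_minimizer: "square_integrable (\<lambda>_. xs)"
  by (simp add: square_integrable_def)

lemma integrable_squared_distance:
  assumes "square_integrable u" "square_integrable v"
  shows "integrable M (\<lambda>\<omega>. (norm (u \<omega> - v \<omega>))\<^sup>2)"
proof (rule Bochner_Integration.integrable_bound)
  show "integrable M (\<lambda>\<omega>. 2 * (norm (u \<omega> - xs))\<^sup>2 + 2 * (norm (v \<omega> - xs))\<^sup>2)"
    using assms unfolding square_integrable_def by auto
  show "(\<lambda>\<omega>. (norm (u \<omega> - v \<omega>))\<^sup>2) \<in> borel_measurable M"
    using assms unfolding square_integrable_def by auto
  have "(norm (u \<omega> - v \<omega>))\<^sup>2 \<le> 2 * (norm (u \<omega> - xs))\<^sup>2 + 2 * (norm (v \<omega> - xs))\<^sup>2" for \<omega>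
    using le_norm_sum_squares[of "u \<omega> - xs" "xs - v \<omega>"] by (simp add: norm_minus_commute)
  then show "AE \<omega> in M. norm ((norm (u \<omega> - v \<omega>))\<^sup>2)
      \<le> norm (2 * (norm (u \<omega> - xs))\<^sup>2 + 2 * (norm (v \<omega> - xs))\<^sup>2)"
    by (intro AE_I2) (auto simp: abs_of_nonneg)
qed

lemma measurable_continuous_functions:
  assumes "u \<in> borel_measurable N"
  shows "(\<lambda>\<omega>. f (u \<omega>)) \<in> borel_measurable N" "(\<lambda>\<omega>. g (u \<omega>)) \<in> borel_measurable N"
    "(\<lambda>\<omega>. f1 (u \<omega>)) \<in> borel_measurable N" "(\<lambda>\<omega>. g1 (u \<omega>)) \<in> borel_measurable N"
    "(\<lambda>\<omega>. residual_f (u \<omega>)) \<in> borel_measurable N" "(\<lambda>\<omega>. residual_g (u \<omega>)) \<in> borel_measurable N"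
    "(\<lambda>\<omega>. residual (u \<omega>)) \<in> borel_measurable N"
    "(\<lambda>\<omega>. grad f1 (u \<omega>)) \<in> borel_measurable N" "(\<lambda>\<omega>. grad g1 (u \<omega>)) \<in> borel_measurable N"
  using continuous_functions continuous_residuals continuous_grad
  by (auto intro: borel_measurable_continuous_on[OF _ assms])

lemma measurable_\<Psi>:
  assumes "u \<in> borel_measurable N" "v \<in> borel_measurable N"
  shows "(\<lambda>\<omega>. \<Psi> (u \<omega>) (v \<omega>)) \<in> borel_measurable N"
  using assms measurable_continuous_functions[OF assms(1)] measurable_continuous_functions[OF assms(2)]
  unfolding \<Psi>_def by simp

lemma integrable_\<Psi>:
  assumes "square_integrable u" "square_integrable v"
  shows "integrable M (\<lambda>\<omega>. \<Psi> (u \<omega>) (v \<omega>))"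
proof (rule Bochner_Integration.integrable_bound)
  show "integrable M (\<lambda>\<omega>. 5 / (8 * \<theta>) * (norm (u \<omega> - v \<omega>))\<^sup>2)"
    by (intro integrable_mult_right integrable_squared_distance assms)
  show "(\<lambda>\<omega>. \<Psi> (u \<omega>) (v \<omega>)) \<in> borel_measurable M"
    using assms unfolding square_integrable_def by (intro measurable_\<Psi>) auto
  show "AE \<omega> in M. norm (\<Psi> (u \<omega>) (v \<omega>)) \<le> norm (5 / (8 * \<theta>) * (norm (u \<omega> - v \<omega>))\<^sup>2)"
    using \<Psi>_upper \<Psi>_nonneg by (intro AE_I2) (smt (verit) real_norm_def)
qed

lemma measurable_noise:
  assumes "u \<in> borel_measurable N" "v \<in> borel_measurable N"
  shows "(\<lambda>\<omega>. noise c (u \<omega>) (v \<omega>)) \<in> borel_measurable N"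
  using assms measurable_continuous_functions[OF assms(1)] measurable_continuous_functions[OF assms(2)]
  unfolding noise_def vrcs_dir_eq by (cases c) auto

lemma integrable_noise_square:
  assumes "square_integrable u" "square_integrable v"
  shows "integrable M (\<lambda>\<omega>. (norm (noise c (u \<omega>) (v \<omega>)))\<^sup>2)"
proof (rule Bochner_Integration.integrable_bound)
  show "integrable M (\<lambda>\<omega>. q / (16 * \<theta>\<^sup>2) / min p (1 - p) * (norm (v \<omega> - u \<omega>))\<^sup>2)"
    by (intro integrable_mult_right integrable_squared_distance assms)
  show "(\<lambda>\<omega>. (norm (noise c (u \<omega>) (v \<omega>)))\<^sup>2) \<in> borel_measurable M"
    using assms measurable_noise[of u M v c] unfolding square_integrable_def by simp
  show "AE \<omega> in M. norm ((norm (noise c (u \<omega>) (v \<omega>)))\<^sup>2)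
      \<le> norm (q / (16 * \<theta>\<^sup>2) / min p (1 - p) * (norm (v \<omega> - u \<omega>))\<^sup>2)"
    using noise_bounded by (intro AE_I2) (smt (verit) real_norm_def zero_le_power2)
qed

lemma integrable_noise_inner:
  assumes "square_integrable u" "square_integrable v" "square_integrable z"
  shows "integrable M (\<lambda>\<omega>. noise c (u \<omega>) (v \<omega>) \<bullet> (z \<omega> - v \<omega>))"
proof (rule Bochner_Integration.integrable_bound)
  show "integrable M (\<lambda>\<omega>. (norm (noise c (u \<omega>) (v \<omega>)))\<^sup>2 + (norm (z \<omega> - v \<omega>))\<^sup>2)"
    by (intro Bochner_Integration.integrable_add integrable_noise_square integrable_squared_distance assms)
  show "(\<lambda>\<omega>. noise c (u \<omega>) (v \<omega>) \<bullet> (z \<omega> - v \<omega>)) \<in> borel_measurable M"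
    using assms measurable_noise[of u M v c] unfolding square_integrable_def
    by (intro borel_measurable_inner borel_measurable_diff) auto
  have "\<bar>noise c (u \<omega>) (v \<omega>) \<bullet> (z \<omega> - v \<omega>)\<bar>
      \<le> (norm (noise c (u \<omega>) (v \<omega>)))\<^sup>2 + (norm (z \<omega> - v \<omega>))\<^sup>2" for \<omega>
  proof -
    have "noise c (u \<omega>) (v \<omega>) \<bullet> (z \<omega> - v \<omega>)
        \<le> (norm (noise c (u \<omega>) (v \<omega>)))\<^sup>2 + (norm (z \<omega> - v \<omega>))\<^sup>2 / 4"
      using young_inner[of 1 "noise c (u \<omega>) (v \<omega>)" "z \<omega> - v \<omega>"] by simp
    moreover have "- (noise c (u \<omega>) (v \<omega>) \<bullet> (z \<omega> - v \<omega>))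
        \<le> (norm (noise c (u \<omega>) (v \<omega>)))\<^sup>2 + (norm (z \<omega> - v \<omega>))\<^sup>2 / 4"
      using young_inner[of 1 "- noise c (u \<omega>) (v \<omega>)" "z \<omega> - v \<omega>"] by simp
    moreover have "0 \<le> (norm (z \<omega> - v \<omega>))\<^sup>2" by simp
    ultimately show ?thesis unfolding abs_le_iff by linarith
  qed
  then show "AE \<omega> in M. norm (noise c (u \<omega>) (v \<omega>) \<bullet> (z \<omega> - v \<omega>))
      \<le> norm ((norm (noise c (u \<omega>) (v \<omega>)))\<^sup>2 + (norm (z \<omega> - v \<omega>))\<^sup>2)"
    by (intro AE_I2) (simp add: abs_of_nonneg)
qed

lemma sets_F_mono:
  assumes "k < K" "s \<le> t"
  shows "sets (F k s) \<subseteq> sets (F k t)"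
  using assms(2) by (induction t rule: dec_induct) (use F_step[OF assms(1)] in auto)

lemma subalgebra_F:
  assumes "k < K" "s \<le> t"
  shows "subalgebra (F k t) (F k s)"
  using F_sub[OF assms(1)] sets_F_mono[OF assms] unfolding subalgebra_def by auto

lemma x_adapted:
  assumes "k < K"
  shows "x k \<in> borel_measurable (F k t)"
proof -
  have "space (F k 0) = space M" using F_sub[OF assms] unfolding subalgebra_def by auto
  then have "y k 0 \<in> borel_measurable (F k 0) \<longleftrightarrow> x k \<in> borel_measurable (F k 0)"
    using y_init[OF assms] by (intro measurable_cong) auto
  then show ?thesis
    using y_adapted[OF assms] measurable_from_subalg[OF subalgebra_F[OF assms, of 0 t]] by auto
qed

lemma y_measurable: "k < K \<Longrightarrow> y k t \<in> borel_measurable M"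
  using measurable_from_subalg[OF F_sub y_adapted] .

lemma b_measurable: "k < K \<Longrightarrow> b k t \<in> measurable M (count_space UNIV)"
  using measurable_from_subalg[OF F_sub b_adapted] .

lemma T_measurable: "k < K \<Longrightarrow> T k \<in> measurable M (count_space UNIV)"
  using T_distr by blast

definition solver_residual :: "nat \<Rightarrow> nat \<Rightarrow> 'w \<Rightarrow> real^'d" where
  "solver_residual k t \<omega> =
     grad (A (vrcs_dir f f1 g g1 p (b k t \<omega>) (x k \<omega>) (y k t \<omega>)) (y k t \<omega>)) (y k (Suc t) \<omega>)"

lemma measurable_solver_residual:
  assumes k: "k < K"
  shows "solver_residual k t \<in> borel_measurable M"
proof -
  have xk: "x k \<in> borel_measurable M"
    using measurable_from_subalg[OF F_sub[OF k] x_adapted[OF k]] .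
  note [measurable] = y_measurable[OF k] xk b_measurable[OF k]
    measurable_continuous_functions[OF y_measurable[OF k]] measurable_continuous_functions[OF xk]
  show ?thesis
    unfolding solver_residual_def[abs_def] grad_subproblem vrcs_dir_eq by measurable
qed

lemma solver_accuracy:
  assumes "k < K"
  shows "(\<integral>\<^sup>+\<omega>. ennreal ((norm (solver_residual k t \<omega>))\<^sup>2) \<partial>M)
    \<le> (\<integral>\<^sup>+\<omega>. ennreal (\<mu> / (17 * \<theta>) * (norm (y k t \<omega> - arg_min
        (A (vrcs_dir f f1 g g1 p (b k t \<omega>) (x k \<omega>) (y k t \<omega>)) (y k t \<omega>)) (\<lambda>_. True)))\<^sup>2) \<partial>M)"
  using solve[OF assms, of t] unfolding Let_def solver_residual_def .

text \<open>
  Second moments are finite at every step. This has to be known before \<open>solver_residual_small\<close> can be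
  proved: the accuracy condition is an inequality in \<open>[0, \<infinity>]\<close> that could hold as \<open>\<infinity> \<le> \<infinity>\<close>, and
  rearranging it requires finite quantities.
\<close>

lemma
  assumes k: "k < K" and x: "square_integrable (x k)" and y: "square_integrable (y k t)"
  shows solver_residual_square_integrable: "integrable M (\<lambda>\<omega>. (norm (solver_residual k t \<omega>))\<^sup>2)"
    and y_Suc_square_integrable: "square_integrable (y k (Suc t))"
proof -
  let ?A = "\<lambda>\<omega>. A (vrcs_dir f f1 g g1 p (b k t \<omega>) (x k \<omega>) (y k t \<omega>)) (y k t \<omega>)"
  let ?xh = "\<lambda>\<omega>. arg_min (?A \<omega>) (\<lambda>_. True)"
  obtain C where C: "0 \<le> C" "\<And>b s y. (norm (grad (A (vrcs_dir f f1 g g1 p b s y) y) xs))\<^sup>2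
      \<le> C * ((norm (y - xs))\<^sup>2 + (norm (s - xs))\<^sup>2)"
    using subproblem_gradient_at_minimizer by blast
  define U where "U \<omega> = (norm (y k t \<omega> - xs))\<^sup>2 + (norm (x k \<omega> - xs))\<^sup>2" for \<omega>
  have U: "integrable M U" "\<And>\<omega>. 0 \<le> U \<omega>"
    using x y unfolding U_def[abs_def] square_integrable_def by auto
  define D where "D = 2 + 2 * ((4 * \<theta> / 3)\<^sup>2 * C)"
  have D: "0 \<le> D" using C(1) by (simp add: D_def)
  have gA: "(norm (grad (?A \<omega>) xs))\<^sup>2 \<le> C * U \<omega>" for \<omega>
    using C(2) unfolding U_def .
  have "(norm (y k t \<omega> - ?xh \<omega>))\<^sup>2 \<le> D * U \<omega>" for \<omega>
  proof -
    have "(norm (y k t \<omega> - ?xh \<omega>))\<^sup>2 \<le> 2 * (norm (y k t \<omega> - xs))\<^sup>2 + 2 * (norm (xs - ?xh \<omega>))\<^sup>2"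
      using le_norm_sum_squares[of "y k t \<omega> - xs" "xs - ?xh \<omega>"] by simp
    also have "(norm (xs - ?xh \<omega>))\<^sup>2 \<le> ((4 * \<theta> / 3) * norm (grad (?A \<omega>) xs))\<^sup>2"
      by (intro power_mono dist_subproblem_minimizer) simp
    also have "\<dots> \<le> (4 * \<theta> / 3)\<^sup>2 * (C * U \<omega>)"
      unfolding power_mult_distrib by (intro mult_left_mono gA) simp
    also have "(norm (y k t \<omega> - xs))\<^sup>2 \<le> U \<omega>" by (simp add: U_def)
    finally show ?thesis by (simp add: D_def algebra_simps)
  qed
  then have "ennreal (\<mu> / (17 * \<theta>) * (norm (y k t \<omega> - ?xh \<omega>))\<^sup>2)
      \<le> ennreal (\<mu> / (17 * \<theta>) * (D * U \<omega>))" for \<omega>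
    using \<mu>_pos \<theta>_pos by (intro ennreal_leI mult_left_mono) auto
  \<comment> \<open>Measurability of \<open>arg_min\<close> is not at hand, but the integral in \<open>[0, \<infinity>]\<close> is monotone for arbitrary functions.\<close>
  then have "(\<integral>\<^sup>+\<omega>. ennreal ((norm (solver_residual k t \<omega>))\<^sup>2) \<partial>M)
      \<le> (\<integral>\<^sup>+\<omega>. ennreal (\<mu> / (17 * \<theta>) * (D * U \<omega>)) \<partial>M)"
    by (intro order_trans[OF solver_accuracy[OF k]] nn_integral_mono)
  also have "\<dots> = ennreal (\<integral>\<omega>. \<mu> / (17 * \<theta>) * (D * U \<omega>) \<partial>M)"
    using U D \<mu>_pos \<theta>_pos by (intro nn_integral_eq_integral) auto
  also have "\<dots> < \<infinity>" by simp
  finally show r: "integrable M (\<lambda>\<omega>. (norm (solver_residual k t \<omega>))\<^sup>2)"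
    using measurable_solver_residual[OF k, of t] by (intro integrableI_nonneg) auto
  have bound: "(norm (y k (Suc t) \<omega> - xs))\<^sup>2
      \<le> (4 * \<theta> / 3)\<^sup>2 * (2 * (norm (solver_residual k t \<omega>))\<^sup>2 + 2 * (C * U \<omega>))" for \<omega>
  proof -
    have "(norm (y k (Suc t) \<omega> - xs))\<^sup>2
        \<le> ((4 * \<theta> / 3) * norm (solver_residual k t \<omega> + - grad (?A \<omega>) xs))\<^sup>2"
      using subproblem_gradient_expansion unfolding solver_residual_def
      by (intro power_mono) auto
    also have "\<dots> \<le> (4 * \<theta> / 3)\<^sup>2 * (2 * (norm (solver_residual k t \<omega>))\<^sup>2 + 2 * (norm (- grad (?A \<omega>) xs))\<^sup>2)"
      unfolding power_mult_distrib by (intro mult_left_mono le_norm_sum_squares) simp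
    also have "\<dots> \<le> (4 * \<theta> / 3)\<^sup>2 * (2 * (norm (solver_residual k t \<omega>))\<^sup>2 + 2 * (C * U \<omega>))"
      using gA[of \<omega>] by (intro mult_left_mono add_mono) auto
    finally show ?thesis .
  qed
  have "integrable M (\<lambda>\<omega>. (norm (y k (Suc t) \<omega> - xs))\<^sup>2)"
  proof (rule Bochner_Integration.integrable_bound)
    show "integrable M (\<lambda>\<omega>. (4 * \<theta> / 3)\<^sup>2 * (2 * (norm (solver_residual k t \<omega>))\<^sup>2 + 2 * (C * U \<omega>)))"
      using r U by auto
    show "(\<lambda>\<omega>. (norm (y k (Suc t) \<omega> - xs))\<^sup>2) \<in> borel_measurable M"
      using y_measurable[OF k, of "Suc t"] by simp
    show "AE \<omega> in M. norm ((norm (y k (Suc t) \<omega> - xs))\<^sup>2)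
        \<le> norm ((4 * \<theta> / 3)\<^sup>2 * (2 * (norm (solver_residual k t \<omega>))\<^sup>2 + 2 * (C * U \<omega>)))"
      using bound by (intro AE_I2) (smt (verit) real_norm_def zero_le_power2)
  qed
  then show "square_integrable (y k (Suc t))"
    using y_measurable[OF k] by (simp add: square_integrable_def)
qed

text \<open>
  The exact minimizer lies within \<open>(4\<theta>/3) \<parallel>r\<parallel>\<close> of the computed point, so the accuracy condition bounds
  \<open>E \<parallel>r\<parallel>\<^sup>2\<close> by \<open>E \<parallel>x\<^sub>t\<^sub>+\<^sub>1 - x\<^sub>t\<parallel>\<^sup>2\<close> and a small multiple of itself. The constant \<open>17\<close> is just large
  enough for the factor \<open>\<mu> / (8\<theta>)\<close>, with which the residual cancels the last third of \<open>\<Psi> w y\<close>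
  in \<open>one_step\<close>.
\<close>

lemma solver_residual_small:
  assumes k: "k < K" and x: "square_integrable (x k)" and y: "square_integrable (y k t)"
  shows "(\<integral>\<omega>. (norm (solver_residual k t \<omega>))\<^sup>2 \<partial>M)
    \<le> \<mu> / (8 * \<theta>) * (\<integral>\<omega>. (norm (y k (Suc t) \<omega> - y k t \<omega>))\<^sup>2 \<partial>M)"
proof -
  note r = solver_residual_square_integrable[OF k x y]
  note d = integrable_squared_distance[OF y_Suc_square_integrable[OF k x y] y]
  let ?A = "\<lambda>\<omega>. A (vrcs_dir f f1 g g1 p (b k t \<omega>) (x k \<omega>) (y k t \<omega>)) (y k t \<omega>)"
  let ?xh = "\<lambda>\<omega>. arg_min (?A \<omega>) (\<lambda>_. True)"
  let ?R = "\<integral>\<omega>. (norm (solver_residual k t \<omega>))\<^sup>2 \<partial>M"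
  let ?D = "\<integral>\<omega>. (norm (y k (Suc t) \<omega> - y k t \<omega>))\<^sup>2 \<partial>M"
  define W where "W \<omega> = 2 * (norm (y k (Suc t) \<omega> - y k t \<omega>))\<^sup>2
      + 2 * ((4 * \<theta> / 3)\<^sup>2 * (norm (solver_residual k t \<omega>))\<^sup>2)" for \<omega>
  have W: "integrable M W" "\<And>\<omega>. 0 \<le> W \<omega>"
    using r d unfolding W_def[abs_def] by auto
  have "(norm (y k t \<omega> - ?xh \<omega>))\<^sup>2 \<le> W \<omega>" for \<omega>
  proof -
    have "(norm (y k t \<omega> - ?xh \<omega>))\<^sup>2
        \<le> 2 * (norm (y k (Suc t) \<omega> - y k t \<omega>))\<^sup>2 + 2 * (norm (y k (Suc t) \<omega> - ?xh \<omega>))\<^sup>2"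
      using le_norm_sum_squares[of "y k t \<omega> - y k (Suc t) \<omega>" "y k (Suc t) \<omega> - ?xh \<omega>"]
      by (simp add: norm_minus_commute)
    also have "(norm (y k (Suc t) \<omega> - ?xh \<omega>))\<^sup>2 \<le> ((4 * \<theta> / 3) * norm (solver_residual k t \<omega>))\<^sup>2"
      unfolding solver_residual_def by (intro power_mono dist_subproblem_minimizer) simp
    finally show ?thesis unfolding W_def power_mult_distrib[of "4 * \<theta> / 3"] by simp
  qed
  then have "ennreal (\<mu> / (17 * \<theta>) * (norm (y k t \<omega> - ?xh \<omega>))\<^sup>2) \<le> ennreal (\<mu> / (17 * \<theta>) * W \<omega>)" for \<omega>
    using \<mu>_pos \<theta>_pos by (intro ennreal_leI mult_left_mono) auto
  then have "(\<integral>\<^sup>+\<omega>. ennreal ((norm (solver_residual k t \<omega>))\<^sup>2) \<partial>M)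
      \<le> (\<integral>\<^sup>+\<omega>. ennreal (\<mu> / (17 * \<theta>) * W \<omega>) \<partial>M)"
    by (intro order_trans[OF solver_accuracy[OF k]] nn_integral_mono)
  then have "ennreal ?R \<le> ennreal (\<integral>\<omega>. \<mu> / (17 * \<theta>) * W \<omega> \<partial>M)"
    using r W \<mu>_pos \<theta>_pos by (simp add: nn_integral_eq_integral)
  then have "?R \<le> (\<integral>\<omega>. \<mu> / (17 * \<theta>) * W \<omega> \<partial>M)"
    using W \<mu>_pos \<theta>_pos by (subst (asm) ennreal_le_iff) (auto intro!: Bochner_Integration.integral_nonneg)
  also have "\<dots> = \<mu> / (17 * \<theta>) * (2 * ?D + 2 * ((4 * \<theta> / 3)\<^sup>2 * ?R))"
    using r d unfolding W_def by simp
  also have "\<dots> = 2 / 17 * (\<mu> / \<theta>) * ?D + 32 / 153 * (\<mu> * \<theta>) * ?R"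
    using \<theta>_pos by (simp add: field_simps power2_eq_square)
  also have "\<mu> * \<theta> \<le> 1 / 5" using conditioning q_less_1 by simp
  finally have "?R \<le> 2 / 17 * (\<mu> / \<theta>) * ?D + 32 / 153 * (1 / 5) * ?R"
    by (simp add: mult_right_mono)
  moreover have "0 \<le> \<mu> / \<theta> * ?D" using \<mu>_pos \<theta>_pos by simp
  ultimately show ?thesis by simp
qed

text \<open>
  The expectation of \<open>one_step\<close>. The reference point may depend on the past of step \<open>t\<close>, since it is
  going to be \<open>x\<^sub>*\<close> or the random starting point of the epoch. Integrability of \<open>h (x\<^sub>t\<^sub>+\<^sub>1)\<close> comes from
  the same inequality as the upper bound, with \<open>h(x\<^sub>*)\<close> as the lower bound.
\<close>

lemma
  assumes k: "k < K" and x: "square_integrable (x k)" and y: "square_integrable (y k t)"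
    and z: "square_integrable z" "z \<in> borel_measurable (F k t)" "integrable M (\<lambda>\<omega>. h (z \<omega>))"
  shows integrable_h_y_Suc: "integrable M (\<lambda>\<omega>. h (y k (Suc t) \<omega>))"
    and expected_progress:
     "(\<integral>\<omega>. h (y k (Suc t) \<omega>) \<partial>M) - (\<integral>\<omega>. h (z \<omega>) \<partial>M)
      \<le> (\<integral>\<omega>. \<Psi> (z \<omega>) (y k t \<omega>) \<partial>M) - (\<integral>\<omega>. \<Psi> (z \<omega>) (y k (Suc t) \<omega>) \<partial>M)
        - \<mu> / 4 * (\<integral>\<omega>. (norm (z \<omega> - y k (Suc t) \<omega>))\<^sup>2 \<partial>M)
        + q / (16 * \<theta>) * (\<integral>\<omega>. (norm (y k t \<omega> - x k \<omega>))\<^sup>2 \<partial>M)"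
proof -
  note w = y_Suc_square_integrable[OF k x y]
  note r = solver_residual_square_integrable[OF k x y]
  let ?n = "\<lambda>c \<omega>. noise c (x k \<omega>) (y k t \<omega>)"
  let ?i = "\<lambda>c \<omega>. ?n c \<omega> \<bullet> (z \<omega> - y k t \<omega>)"
  let ?v = "\<lambda>c \<omega>. (norm (?n c \<omega>))\<^sup>2"
  have meas_n: "?n c \<in> borel_measurable (F k t)" for c
    by (intro measurable_noise x_adapted[OF k] y_adapted[OF k])
  have meas: "?i c \<in> borel_measurable (F k t)" "?v c \<in> borel_measurable (F k t)" for c
    using meas_n[of c] z(2) y_adapted[OF k, of t] by simp_all
  note bern = F_sub[OF k] b_indep[OF k] b_measurable[OF k] b_distr[OF k]
    less_imp_le[OF p_pos] less_imp_le[OF p_less_1]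
  note ii = integrable_noise_inner[OF x y z(1)] and iv = integrable_noise_square[OF x y]
  have if_i: "(\<lambda>\<omega>. ?i (b k t \<omega>) \<omega>) = (\<lambda>\<omega>. if b k t \<omega> then ?i True \<omega> else ?i False \<omega>)" by auto
  have if_v: "(\<lambda>\<omega>. ?v (b k t \<omega>) \<omega>) = (\<lambda>\<omega>. if b k t \<omega> then ?v True \<omega> else ?v False \<omega>)" by auto
  have Ii: "integrable M (\<lambda>\<omega>. ?i (b k t \<omega>) \<omega>)"
    unfolding if_i by (rule integrable_indep_bernoulli[OF bern meas(1) ii meas(1) ii])
  have Iv: "integrable M (\<lambda>\<omega>. ?v (b k t \<omega>) \<omega>)"
    unfolding if_v by (rule integrable_indep_bernoulli[OF bern meas(2) iv meas(2) iv])
  have "(\<integral>\<omega>. ?i (b k t \<omega>) \<omega> \<partial>M) = p * (\<integral>\<omega>. ?i True \<omega> \<partial>M) + (1 - p) * (\<integral>\<omega>. ?i False \<omega> \<partial>M)"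
    unfolding if_i by (rule expectation_indep_bernoulli[OF bern meas(1) ii meas(1) ii])
  also have "\<dots> = (\<integral>\<omega>. (p *\<^sub>R ?n True \<omega> + (1 - p) *\<^sub>R ?n False \<omega>) \<bullet> (z \<omega> - y k t \<omega>) \<partial>M)"
    using ii by (simp add: inner_add_left)
  also have "\<dots> = 0" by (simp add: noise_mean)
  finally have mean: "(\<integral>\<omega>. ?i (b k t \<omega>) \<omega> \<partial>M) = 0" .
  have "(\<integral>\<omega>. ?v (b k t \<omega>) \<omega> \<partial>M) = p * (\<integral>\<omega>. ?v True \<omega> \<partial>M) + (1 - p) * (\<integral>\<omega>. ?v False \<omega> \<partial>M)"
    unfolding if_v by (rule expectation_indep_bernoulli[OF bern meas(2) iv meas(2) iv])
  also have "\<dots> = (\<integral>\<omega>. p * ?v True \<omega> + (1 - p) * ?v False \<omega> \<partial>M)"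
    using iv by simp
  also have "\<dots> \<le> (\<integral>\<omega>. q / (16 * \<theta>\<^sup>2) * (norm (y k t \<omega> - x k \<omega>))\<^sup>2 \<partial>M)"
    using iv integrable_squared_distance[OF y x] noise_variance by (intro integral_mono) auto
  finally have "\<theta> * (\<integral>\<omega>. ?v (b k t \<omega>) \<omega> \<partial>M)
      \<le> \<theta> * (\<integral>\<omega>. q / (16 * \<theta>\<^sup>2) * (norm (y k t \<omega> - x k \<omega>))\<^sup>2 \<partial>M)"
    using \<theta>_pos by (intro mult_left_mono) auto
  then have var: "\<theta> * (\<integral>\<omega>. ?v (b k t \<omega>) \<omega> \<partial>M)
      \<le> q / (16 * \<theta>) * (\<integral>\<omega>. (norm (y k t \<omega> - x k \<omega>))\<^sup>2 \<partial>M)"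
    using \<theta>_pos by (simp add: field_simps power2_eq_square)
  have res: "(\<integral>\<omega>. (norm (solver_residual k t \<omega>))\<^sup>2 \<partial>M) / \<mu>
      - (\<integral>\<omega>. (norm (y k (Suc t) \<omega> - y k t \<omega>))\<^sup>2 \<partial>M) / (8 * \<theta>) \<le> 0"
    using solver_residual_small[OF k x y] \<mu>_pos \<theta>_pos by (simp add: field_simps)
  define B where "B \<omega> = \<Psi> (z \<omega>) (y k t \<omega>) - \<Psi> (z \<omega>) (y k (Suc t) \<omega>)
     - \<mu> / 4 * (norm (z \<omega> - y k (Suc t) \<omega>))\<^sup>2
     + ((norm (solver_residual k t \<omega>))\<^sup>2 / \<mu> - (norm (y k (Suc t) \<omega> - y k t \<omega>))\<^sup>2 / (8 * \<theta>))
     + ?i (b k t \<omega>) \<omega> + \<theta> * ?v (b k t \<omega>) \<omega>" for \<omega>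
  note ints = integrable_\<Psi>[OF z(1) y] integrable_\<Psi>[OF z(1) w] integrable_squared_distance[OF z(1) w]
    integrable_squared_distance[OF w y] r Ii Iv
  have B: "integrable M B" using ints unfolding B_def[abs_def] by auto
  have EB: "(\<integral>\<omega>. B \<omega> \<partial>M) = (\<integral>\<omega>. \<Psi> (z \<omega>) (y k t \<omega>) \<partial>M) - (\<integral>\<omega>. \<Psi> (z \<omega>) (y k (Suc t) \<omega>) \<partial>M)
     - \<mu> / 4 * (\<integral>\<omega>. (norm (z \<omega> - y k (Suc t) \<omega>))\<^sup>2 \<partial>M)
     + ((\<integral>\<omega>. (norm (solver_residual k t \<omega>))\<^sup>2 \<partial>M) / \<mu>
        - (\<integral>\<omega>. (norm (y k (Suc t) \<omega> - y k t \<omega>))\<^sup>2 \<partial>M) / (8 * \<theta>))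
     + (\<integral>\<omega>. ?i (b k t \<omega>) \<omega> \<partial>M) + \<theta> * (\<integral>\<omega>. ?v (b k t \<omega>) \<omega> \<partial>M)"
    using ints unfolding B_def by simp
  have le: "h (y k (Suc t) \<omega>) \<le> h (z \<omega>) + B \<omega>" for \<omega>
    using one_step[of "y k (Suc t) \<omega>" "z \<omega>" "y k t \<omega>" "b k t \<omega>" "x k \<omega>"]
    unfolding B_def solver_residual_def by linarith
  show int: "integrable M (\<lambda>\<omega>. h (y k (Suc t) \<omega>))"
  proof (rule Bochner_Integration.integrable_bound)
    show "integrable M (\<lambda>\<omega>. \<bar>h xs\<bar> + \<bar>h (z \<omega>) + B \<omega>\<bar>)"
      by (intro Bochner_Integration.integrable_add integrable_abs z(3) B integrable_const)
    show "(\<lambda>\<omega>. h (y k (Suc t) \<omega>)) \<in> borel_measurable M"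
      by (intro borel_measurable_add measurable_continuous_functions y_measurable[OF k])
    show "AE \<omega> in M. norm (h (y k (Suc t) \<omega>)) \<le> norm (\<bar>h xs\<bar> + \<bar>h (z \<omega>) + B \<omega>\<bar>)"
      using le minimizer by (intro AE_I2) (smt (verit) real_norm_def)
  qed
  have "(\<integral>\<omega>. h (y k (Suc t) \<omega>) \<partial>M) \<le> (\<integral>\<omega>. h (z \<omega>) + B \<omega> \<partial>M)"
    by (rule integral_mono[OF int Bochner_Integration.integrable_add[OF z(3) B] le])
  also have "\<dots> = (\<integral>\<omega>. h (z \<omega>) \<partial>M) + (\<integral>\<omega>. B \<omega> \<partial>M)"
    by (rule Bochner_Integration.integral_add[OF z(3) B])
  finally show "(\<integral>\<omega>. h (y k (Suc t) \<omega>) \<partial>M) - (\<integral>\<omega>. h (z \<omega>) \<partial>M)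
      \<le> (\<integral>\<omega>. \<Psi> (z \<omega>) (y k t \<omega>) \<partial>M) - (\<integral>\<omega>. \<Psi> (z \<omega>) (y k (Suc t) \<omega>) \<partial>M)
        - \<mu> / 4 * (\<integral>\<omega>. (norm (z \<omega> - y k (Suc t) \<omega>))\<^sup>2 \<partial>M)
        + q / (16 * \<theta>) * (\<integral>\<omega>. (norm (y k t \<omega> - x k \<omega>))\<^sup>2 \<partial>M)"
    using EB mean var res by linarith
qed

end

section \<open>Contraction\<close>

context vrcs_problem
begin

text \<open>
  The largest factor for which the lemma \<open>\<Psi>_upper\<close> keeps \<open>\<rho> q \<Psi>(x\<^sub>*, \<cdot>)\<close> below \<open>\<mu>/4 \<parallel>x\<^sub>* - \<cdot>\<parallel>\<^sup>2\<close>, the strong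
  convexity that the residual leaves in \<open>one_step\<close>.
\<close>

definition \<rho> :: real where
  "\<rho> = 2 * \<mu> * \<theta> / (5 * q)"

definition potential :: "real^'d \<Rightarrow> real" where
  "potential z = (1 + \<rho> / 5) * (h z - h xs) + \<rho> * q * \<Psi> xs z"

lemma \<rho>_pos: "0 < \<rho>"
  using \<mu>_pos \<theta>_pos q_pos by (simp add: \<rho>_def)

lemma \<rho>_le_1: "\<rho> \<le> 1"
  using conditioning q_pos by (simp add: \<rho>_def field_simps)

lemma \<Psi>_le_distance: "\<rho> * q * \<Psi> xs z \<le> \<mu> / 4 * (norm (xs - z))\<^sup>2"
proof -
  have "\<rho> * q * \<Psi> xs z \<le> \<rho> * q * (5 / (8 * \<theta>) * (norm (xs - z))\<^sup>2)"
    using \<rho>_pos q_pos by (intro mult_left_mono \<Psi>_upper) auto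
  also have "\<dots> = \<mu> / 4 * (norm (xs - z))\<^sup>2"
    using \<theta>_pos q_pos by (simp add: \<rho>_def field_simps)
  finally show ?thesis .
qed

lemma gap_le_potential: "h z - h xs \<le> potential z"
proof -
  have "0 \<le> \<rho> / 5 * (h z - h xs)" "0 \<le> \<rho> * q * \<Psi> xs z"
    using \<rho>_pos q_pos \<Psi>_nonneg minimizer[of z] by simp_all
  then show ?thesis unfolding potential_def by (simp add: distrib_right)
qed

lemma potential_nonneg: "0 \<le> potential z"
  using gap_le_potential[of z] minimizer[of z] by linarith

text \<open>
  Together with \<open>gap_le_potential\<close> this makes the potential equivalent to the gap in \<open>h\<close> up to the
  factor 2, independently of the condition number.
\<close>

lemma potential_le_gap: "potential z \<le> 2 * (h z - h xs)"
proof -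
  have "\<rho> * q * \<Psi> xs z \<le> 1 / 2 * (h z - h xs)"
    using \<Psi>_le_distance[of z] h_growth[of z] by (simp add: norm_minus_commute)
  moreover have "\<rho> / 5 * (h z - h xs) \<le> 1 / 5 * (h z - h xs)"
    using \<rho>_le_1 minimizer[of z] by (intro mult_right_mono) auto
  ultimately show ?thesis
    unfolding potential_def using minimizer[of z] by (simp add: distrib_right)
qed

end

context vrcs_analysis
begin

lemma measurable_potential:
  assumes "u \<in> borel_measurable N"
  shows "(\<lambda>\<omega>. potential (u \<omega>)) \<in> borel_measurable N"
  unfolding potential_def
  by (intro borel_measurable_add borel_measurable_times borel_measurable_diff borel_measurable_const
      measurable_continuous_functions measurable_\<Psi> assms)

lemma
  assumes u: "u \<in> borel_measurable M" "integrable M (\<lambda>\<omega>. potential (u \<omega>))"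
  shows integrable_h_of_potential: "integrable M (\<lambda>\<omega>. h (u \<omega>))"
    and square_integrable_of_potential: "square_integrable u"
proof -
  have gap: "integrable M (\<lambda>\<omega>. h (u \<omega>) - h xs)"
  proof (rule Bochner_Integration.integrable_bound[OF u(2)])
    show "(\<lambda>\<omega>. h (u \<omega>) - h xs) \<in> borel_measurable M"
      by (intro borel_measurable_add borel_measurable_diff borel_measurable_const
          measurable_continuous_functions u)
    show "AE \<omega> in M. norm (h (u \<omega>) - h xs) \<le> norm (potential (u \<omega>))"
      using gap_le_potential minimizer by (intro AE_I2) (smt (verit) real_norm_def)
  qed
  from Bochner_Integration.integrable_add[OF this integrable_const[of "h xs"]]
  show "integrable M (\<lambda>\<omega>. h (u \<omega>))" by simp
  have "integrable M (\<lambda>\<omega>. (norm (u \<omega> - xs))\<^sup>2)"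
  proof (rule Bochner_Integration.integrable_bound)
    show "integrable M (\<lambda>\<omega>. 2 / \<mu> * (h (u \<omega>) - h xs))" by (intro integrable_mult_right gap)
    show "(\<lambda>\<omega>. (norm (u \<omega> - xs))\<^sup>2) \<in> borel_measurable M" using u by simp
    have "(norm (z - xs))\<^sup>2 \<le> 2 / \<mu> * (h z - h xs)" for z
      using h_growth[of z] \<mu>_pos by (simp add: field_simps)
    then show "AE \<omega> in M. norm ((norm (u \<omega> - xs))\<^sup>2) \<le> norm (2 / \<mu> * (h (u \<omega>) - h xs))"
      by (intro AE_I2) (smt (verit) real_norm_def zero_le_power2)
  qed
  then show "square_integrable u" using u by (simp add: square_integrable_def)
qed

lemma x_Suc_measurable:
  assumes k: "k < K"
  shows "x (Suc k) \<in> borel_measurable M"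
proof -
  have "(\<lambda>\<omega>. y k (T k \<omega>) \<omega>) \<in> borel_measurable M"
    by (rule measurable_compose_countable[OF y_measurable[OF k] T_measurable[OF k]])
  then show ?thesis
    using x_next[OF k] by (subst measurable_cong) auto
qed

text \<open>
  \<open>epoch_recursion_contracts\<close> at the fixed inner times, carried over to the random end of the epoch.
  The coefficient \<open>c = q / (16\<theta>)\<close> is \<open>\<theta>\<close> times the variance constant, and \<open>6 c = 3 q / (8\<theta>)\<close> is \<open>q\<close> times
  the lower constant of \<open>\<Psi>\<close>.
\<close>

lemma
  assumes k: "k < K" and x: "square_integrable (x k)" "integrable M (\<lambda>\<omega>. h (x k \<omega>))"
  shows epoch_integrable: "integrable M (\<lambda>\<omega>. potential (x (Suc k) \<omega>))"
    and epoch_contraction: "(1 + \<rho> / 2) * (\<integral>\<omega>. potential (x (Suc k) \<omega>) \<partial>M) \<le> (\<integral>\<omega>. potential (x k \<omega>) \<partial>M)"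
proof -
  have "square_integrable (y k t) \<and> integrable M (\<lambda>\<omega>. h (y k t \<omega>))" for t
  proof (induction t)
    case 0
    have "integrable M (\<lambda>\<omega>. (norm (y k 0 \<omega> - xs))\<^sup>2) = integrable M (\<lambda>\<omega>. (norm (x k \<omega> - xs))\<^sup>2)"
      "integrable M (\<lambda>\<omega>. h (y k 0 \<omega>)) = integrable M (\<lambda>\<omega>. h (x k \<omega>))"
      using y_init[OF k] by (auto intro!: Bochner_Integration.integrable_cong)
    then show ?case using x y_measurable[OF k] by (simp add: square_integrable_def)
  next
    case (Suc t)
    then show ?case
      using y_Suc_square_integrable[OF k x(1), of t]
        integrable_h_y_Suc[OF k x(1) _ x(1) x_adapted[OF k] x(2), of t] by blast
  qed
  then have y: "square_integrable (y k t)" and hy: "integrable M (\<lambda>\<omega>. h (y k t \<omega>))" for t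
    by auto
  define H where "H t = (\<integral>\<omega>. h (y k t \<omega>) \<partial>M) - h xs" for t
  define P where "P t = (\<integral>\<omega>. \<Psi> xs (y k t \<omega>) \<partial>M)" for t
  define N where "N t = (\<integral>\<omega>. (norm (xs - y k t \<omega>))\<^sup>2 \<partial>M)" for t
  define Q where "Q t = (\<integral>\<omega>. \<Psi> (x k \<omega>) (y k t \<omega>) \<partial>M)" for t
  define d where "d t = (\<integral>\<omega>. (norm (y k t \<omega> - x k \<omega>))\<^sup>2 \<partial>M)" for t
  note xs_int = integrable_\<Psi>[OF square_integrable_minimizer y]
  have start: "(\<integral>\<omega>. h (y k 0 \<omega>) \<partial>M) = (\<integral>\<omega>. h (x k \<omega>) \<partial>M)"
      "(\<integral>\<omega>. potential (y k 0 \<omega>) \<partial>M) = (\<integral>\<omega>. potential (x k \<omega>) \<partial>M)"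
    using y_init[OF k] by (auto intro!: Bochner_Integration.integral_cong)
  have "Q 0 = (\<integral>\<omega>. 0 \<partial>M)"
    unfolding Q_def by (intro Bochner_Integration.integral_cong refl) (simp add: y_init[OF k])
  moreover have "d 0 = (\<integral>\<omega>. 0 \<partial>M)"
    unfolding d_def by (intro Bochner_Integration.integral_cong refl) (simp add: y_init[OF k])
  ultimately have start_0: "Q 0 = 0" "d 0 = 0" by simp_all
  have pot: "(\<integral>\<omega>. potential (y k t \<omega>) \<partial>M) = (1 + \<rho> / 5) * H t + \<rho> * q * P t" for t
    unfolding potential_def H_def P_def using xs_int[of t] hy[of t]
    by (simp add: prob_space)
  have pot_int: "integrable M (\<lambda>\<omega>. potential (y k t \<omega>))" for t
    unfolding potential_def using xs_int[of t] hy[of t] by auto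
  have bound: "(1 + \<rho> / 2) * (\<Sum>j<n. q * (1 - q) ^ j * ((1 + \<rho> / 5) * H (Suc j) + \<rho> * q * P (Suc j)))
      \<le> (1 + \<rho> / 5) * H 0 + \<rho> * q * P 0" for n
  proof (rule epoch_recursion_contracts[where c = "q / (16 * \<theta>)" and m = "\<mu> / 4" and N = N and Q = Q and d = d])
    show "H (Suc t) - H 0 \<le> Q t - Q (Suc t) + q / (16 * \<theta>) * d t" for t
    proof -
      have "0 \<le> \<mu> / 4 * (\<integral>\<omega>. (norm (x k \<omega> - y k (Suc t) \<omega>))\<^sup>2 \<partial>M)"
        using \<mu>_pos by simp
      then show ?thesis
        using expected_progress[OF k x(1) y[of t] x(1) x_adapted[OF k] x(2)] start(1)
        unfolding H_def Q_def d_def by linarith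
    qed
    show "H (Suc t) \<le> P t - P (Suc t) - \<mu> / 4 * N (Suc t) + q / (16 * \<theta>) * d t" for t
      using expected_progress[OF k x(1) y[of t] square_integrable_minimizer]
      unfolding H_def P_def N_def d_def by (simp add: prob_space)
    show "\<rho> * q * P t \<le> \<mu> / 4 * N t" for t
    proof -
      have "(\<integral>\<omega>. \<rho> * q * \<Psi> xs (y k t \<omega>) \<partial>M) \<le> (\<integral>\<omega>. \<mu> / 4 * (norm (xs - y k t \<omega>))\<^sup>2 \<partial>M)"
        by (intro integral_mono integrable_mult_right xs_int \<Psi>_le_distance
            integrable_squared_distance square_integrable_minimizer y)
      then show ?thesis unfolding P_def N_def by simp
    qed
    show "6 * (q / (16 * \<theta>)) * d t \<le> q * Q t" for t
    proof -
      have "(\<integral>\<omega>. 3 / (8 * \<theta>) * (norm (y k t \<omega> - x k \<omega>))\<^sup>2 \<partial>M) \<le> Q t"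
        unfolding Q_def using \<Psi>_lower
        by (intro integral_mono integrable_mult_right integrable_\<Psi> integrable_squared_distance x(1) y)
           (simp add: norm_minus_commute)
      then have "q * (3 / (8 * \<theta>) * d t) \<le> q * Q t"
        unfolding d_def using q_pos by (intro mult_left_mono) auto
      then show ?thesis by simp
    qed
    show "0 \<le> H t" for t
    proof -
      have "(\<integral>\<omega>. h xs \<partial>M) \<le> (\<integral>\<omega>. h (y k t \<omega>) \<partial>M)"
        by (intro integral_mono hy minimizer integrable_const)
      then show ?thesis by (simp add: H_def prob_space)
    qed
  qed (use q_pos q_less_1 \<rho>_pos \<rho>_le_1 \<theta>_pos start_0 in
      \<open>auto simp: P_def d_def \<Psi>_nonneg intro!: Bochner_Integration.integral_nonneg\<close>)
  have bound': "(\<Sum>j<n. q * (1 - q) ^ j * (\<integral>\<omega>. potential (y k (Suc j) \<omega>) \<partial>M))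
      \<le> (\<integral>\<omega>. potential (x k \<omega>) \<partial>M) / (1 + \<rho> / 2)" for n
  proof (subst pos_le_divide_eq)
    show "0 < 1 + \<rho> / 2" using \<rho>_pos by simp
    show "(\<Sum>j<n. q * (1 - q) ^ j * (\<integral>\<omega>. potential (y k (Suc j) \<omega>) \<partial>M)) * (1 + \<rho> / 2)
        \<le> (\<integral>\<omega>. potential (x k \<omega>) \<partial>M)"
      unfolding start(2)[symmetric] pot using bound[of n] by (simp only: mult.commute)
  qed
  note time = F_sub[OF k] T_indep[OF k] T_measurable[OF k] conjunct2[OF T_distr[OF k]] q_pos
    less_imp_le[OF q_less_1] measurable_potential[OF y_adapted[OF k]] pot_int potential_nonneg bound'
  have eq: "potential (x (Suc k) \<omega>) = potential (y k (T k \<omega>) \<omega>)" if "\<omega> \<in> space M" for \<omega>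
    using x_next[OF k that] by simp
  have "integrable M (\<lambda>\<omega>. potential (y k (T k \<omega>) \<omega>))"
    by (rule integrable_at_geometric_time[OF time])
  then show "integrable M (\<lambda>\<omega>. potential (x (Suc k) \<omega>))"
    using eq by (subst Bochner_Integration.integrable_cong[OF refl]) auto
  have "(\<integral>\<omega>. potential (y k (T k \<omega>) \<omega>) \<partial>M) \<le> (\<integral>\<omega>. potential (x k \<omega>) \<partial>M) / (1 + \<rho> / 2)"
    by (rule expectation_at_geometric_time[OF time])
  also have "(\<integral>\<omega>. potential (y k (T k \<omega>) \<omega>) \<partial>M) = (\<integral>\<omega>. potential (x (Suc k) \<omega>) \<partial>M)"
    using eq by (intro Bochner_Integration.integral_cong) auto
  finally show "(1 + \<rho> / 2) * (\<integral>\<omega>. potential (x (Suc k) \<omega>) \<partial>M) \<le> (\<integral>\<omega>. potential (x k \<omega>) \<partial>M)"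
    using \<rho>_pos by (simp add: field_simps)
qed

lemma potential_after_epochs:
  assumes "k \<le> K"
  shows "x k \<in> borel_measurable M \<and> integrable M (\<lambda>\<omega>. potential (x k \<omega>)) \<and>
    (\<integral>\<omega>. potential (x k \<omega>) \<partial>M) \<le> potential x0 / (1 + \<rho> / 2) ^ k"
  using assms
proof (induction k)
  case 0
  have "x 0 \<in> borel_measurable M \<longleftrightarrow> (\<lambda>_. x0) \<in> borel_measurable M"
    using x_init by (intro measurable_cong) auto
  moreover have "integrable M (\<lambda>\<omega>. potential (x 0 \<omega>)) \<longleftrightarrow> integrable M (\<lambda>_. potential x0)"
    using x_init by (intro Bochner_Integration.integrable_cong) auto
  moreover have "(\<integral>\<omega>. potential (x 0 \<omega>) \<partial>M) = (\<integral>\<omega>. potential x0 \<partial>M)"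
    using x_init by (intro Bochner_Integration.integral_cong) auto
  ultimately show ?case by (simp add: prob_space)
next
  case (Suc k)
  then have k: "k < K" and IH: "x k \<in> borel_measurable M" "integrable M (\<lambda>\<omega>. potential (x k \<omega>))"
    "(\<integral>\<omega>. potential (x k \<omega>) \<partial>M) \<le> potential x0 / (1 + \<rho> / 2) ^ k"
    by auto
  note epoch = k square_integrable_of_potential[OF IH(1,2)] integrable_h_of_potential[OF IH(1,2)]
  have "(1 + \<rho> / 2) * (\<integral>\<omega>. potential (x (Suc k) \<omega>) \<partial>M) \<le> potential x0 / (1 + \<rho> / 2) ^ k"
    using epoch_contraction[OF epoch] IH(3) by linarith
  then have "(\<integral>\<omega>. potential (x (Suc k) \<omega>) \<partial>M) \<le> potential x0 / (1 + \<rho> / 2) ^ k / (1 + \<rho> / 2)"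
    using \<rho>_pos by (subst pos_le_divide_eq) (auto simp: mult.commute)
  then show ?case
    using x_Suc_measurable[OF k] epoch_integrable[OF epoch] by (simp add: mult.commute)
qed

lemma
  shows integrable_output_gap: "integrable M (\<lambda>\<omega>. h (x K \<omega>) - h xs)"
    and expected_output_gap:
      "(\<integral>\<omega>. h (x K \<omega>) - h xs \<partial>M) \<le> 2 * (h x0 - h xs) / (1 + \<rho> / 2) ^ K"
proof -
  have K: "x K \<in> borel_measurable M" "integrable M (\<lambda>\<omega>. potential (x K \<omega>))"
    "(\<integral>\<omega>. potential (x K \<omega>) \<partial>M) \<le> potential x0 / (1 + \<rho> / 2) ^ K"
    using potential_after_epochs[of K] by auto
  show int: "integrable M (\<lambda>\<omega>. h (x K \<omega>) - h xs)"
    by (intro Bochner_Integration.integrable_diff integrable_h_of_potential[OF K(1,2)] integrable_const)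
  have "(\<integral>\<omega>. h (x K \<omega>) - h xs \<partial>M) \<le> (\<integral>\<omega>. potential (x K \<omega>) \<partial>M)"
    by (intro integral_mono int K(2) gap_le_potential)
  also have "\<dots> \<le> potential x0 / (1 + \<rho> / 2) ^ K" by (rule K(3))
  also have "\<dots> \<le> 2 * (h x0 - h xs) / (1 + \<rho> / 2) ^ K"
    using \<rho>_pos by (intro divide_right_mono potential_le_gap) auto
  finally show "(\<integral>\<omega>. h (x K \<omega>) - h xs \<partial>M) \<le> 2 * (h x0 - h xs) / (1 + \<rho> / 2) ^ K" .
qed

section \<open>Communication\<close>

text \<open>
  The number of draws up to a fixed time is determined by the past of that time, so the counts are
  again quantities observed at an independent geometric time. This gives Wald's identity, of which one
  inequality is needed.
\<close>

lemma
  assumes k: "k < K"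
  shows integrable_draw_count: "integrable M (\<lambda>\<omega>. real (card {t. t < T k \<omega> \<and> b k t \<omega> = c}))"
    and expected_draw_count:
      "(\<integral>\<omega>. real (card {t. t < T k \<omega> \<and> b k t \<omega> = c}) \<partial>M) \<le> (if c then p else 1 - p) / q"
proof -
  define G where "G t \<omega> = real (card {s. s < t \<and> b k s \<omega> = c})" for t \<omega>
  have G: "G t = (\<lambda>\<omega>. \<Sum>s<t. indicator {c} (b k s \<omega>))" for t
  proof
    fix \<omega>
    have "G t \<omega> = (\<Sum>s\<in>{s \<in> {..<t}. b k s \<omega> = c}. 1)" by (simp add: G_def)
    also have "\<dots> = (\<Sum>s<t. if b k s \<omega> = c then 1 else 0)" by (rule sum.inter_filter) simp
    also have "\<dots> = (\<Sum>s<t. indicator {c} (b k s \<omega>))" by (intro sum.cong) (auto simp: indicator_def)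
    finally show "G t \<omega> = (\<Sum>s<t. indicator {c} (b k s \<omega>))" .
  qed
  have adapted: "G t \<in> borel_measurable (F k t)" for t
  proof -
    have "(\<lambda>\<omega>. indicator {c} (b k s \<omega>) :: real) \<in> borel_measurable (F k t)" if "s < t" for s
    proof -
      have "b k s \<in> measurable (F k t) (count_space UNIV)"
        using measurable_from_subalg[OF subalgebra_F[OF k, of "Suc s" t] b_adapted[OF k]] that by simp
      then show ?thesis by (rule measurable_compose) simp
    qed
    then show ?thesis unfolding G by (intro borel_measurable_sum) auto
  qed
  have ind: "integrable M (\<lambda>\<omega>. indicator {c} (b k s \<omega>) :: real)"
      "(\<integral>\<omega>. indicator {c} (b k s \<omega>) \<partial>M) = (if c then p else 1 - p)" for s
  proof -
    have sets: "{\<omega> \<in> space M. b k s \<omega> \<in> {c}} \<in> events"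
      using measurable_sets[OF b_measurable[OF k, of s], of "{c}"] by (simp add: vimage_def Int_def conj_commute)
    have "(\<integral>\<omega>. indicator {c} (b k s \<omega>) \<partial>M) = (\<integral>\<omega>. indicator {\<omega> \<in> space M. b k s \<omega> \<in> {c}} \<omega> \<partial>M)"
      by (intro Bochner_Integration.integral_cong) (auto simp: indicator_def)
    also have "\<dots> = prob {\<omega> \<in> space M. b k s \<omega> \<in> {c}}" using sets by simp
    also have "\<dots> = pmf (bernoulli_pmf p) c"
      by (rule prob_eq_pmf[OF b_measurable[OF k] b_distr[OF k]])
    also have "\<dots> = (if c then p else 1 - p)" using p_pos p_less_1 by (cases c) simp_all
    finally show "(\<integral>\<omega>. indicator {c} (b k s \<omega>) \<partial>M) = (if c then p else 1 - p)" .
    show "integrable M (\<lambda>\<omega>. indicator {c} (b k s \<omega>) :: real)"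
    proof (rule integrable_const_bound[where B = 1])
      show "(\<lambda>\<omega>. indicator {c} (b k s \<omega>) :: real) \<in> borel_measurable M"
        by (rule measurable_compose[OF b_measurable[OF k]]) simp
    qed (auto simp: indicator_def)
  qed
  have intG: "integrable M (G t)" for t unfolding G using ind(1) by auto
  have EG: "(\<integral>\<omega>. G t \<omega> \<partial>M) = real t * (if c then p else 1 - p)" for t
    unfolding G by (subst Bochner_Integration.integral_sum) (use ind in auto)
  have bound: "(\<Sum>j<n. q * (1 - q) ^ j * (\<integral>\<omega>. G (Suc j) \<omega> \<partial>M)) \<le> (if c then p else 1 - p) / q" for n
  proof -
    let ?p = "if c then p else 1 - p"
    have "(\<Sum>j<n. q * (1 - q) ^ j * (\<integral>\<omega>. G (Suc j) \<omega> \<partial>M)) = (\<Sum>j<n. q * (1 - q) ^ j * real (Suc j)) * ?p"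
      unfolding EG sum_distrib_right by (simp only: mult.assoc)
    also have "\<dots> \<le> 1 / q * ?p"
      using sum_geometric_weights_mean[of q n] q_pos q_less_1 p_pos p_less_1
      by (intro mult_right_mono) auto
    finally show ?thesis by simp
  qed
  have nonneg: "0 \<le> G t \<omega>" for t \<omega> by (simp add: G_def)
  note time = F_sub[OF k] T_indep[OF k] T_measurable[OF k] conjunct2[OF T_distr[OF k]] q_pos
    less_imp_le[OF q_less_1] adapted intG nonneg bound
  show "integrable M (\<lambda>\<omega>. real (card {t. t < T k \<omega> \<and> b k t \<omega> = c}))"
    using integrable_at_geometric_time[OF time] unfolding G_def .
  show "(\<integral>\<omega>. real (card {t. t < T k \<omega> \<and> b k t \<omega> = c}) \<partial>M) \<le> (if c then p else 1 - p) / q"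
    using expectation_at_geometric_time[OF time] unfolding G_def .
qed

lemma
  shows integrable_rounds_f: "integrable M (\<lambda>\<omega>. real (rounds_f K T b \<omega>))"
    and expected_rounds_f: "(\<integral>\<omega>. real (rounds_f K T b \<omega>) \<partial>M) \<le> real K * (1 + p / q)"
    and integrable_rounds_g: "integrable M (\<lambda>\<omega>. real (rounds_g K T b \<omega>))"
    and expected_rounds_g: "(\<integral>\<omega>. real (rounds_g K T b \<omega>) \<partial>M) \<le> real K * (1 + (1 - p) / q)"
proof -
  let ?n = "\<lambda>c k \<omega>. 1 + real (card {t. t < T k \<omega> \<and> b k t \<omega> = c})"
  have n: "integrable M (?n c k)" "(\<integral>\<omega>. ?n c k \<omega> \<partial>M) \<le> 1 + (if c then p else 1 - p) / q" if "k < K" for c k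
    using integrable_draw_count[OF that, of c] expected_draw_count[OF that, of c]
    by (simp_all add: prob_space)
  have int: "integrable M (\<lambda>\<omega>. \<Sum>k<K. ?n c k \<omega>)" for c
    using n(1) by (intro Bochner_Integration.integrable_sum) auto
  have E: "(\<integral>\<omega>. (\<Sum>k<K. ?n c k \<omega>) \<partial>M) \<le> real K * (1 + (if c then p else 1 - p) / q)" for c
  proof -
    have "(\<integral>\<omega>. (\<Sum>k<K. ?n c k \<omega>) \<partial>M) = (\<Sum>k<K. \<integral>\<omega>. ?n c k \<omega> \<partial>M)"
      using n(1) by (intro Bochner_Integration.integral_sum) auto
    also have "\<dots> \<le> (\<Sum>k<K. 1 + (if c then p else 1 - p) / q)"
      using n(2) by (intro sum_mono) auto
    finally show ?thesis by simp
  qed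
  have f: "real (rounds_f K T b \<omega>) = (\<Sum>k<K. ?n True k \<omega>)"
    and g: "real (rounds_g K T b \<omega>) = (\<Sum>k<K. ?n False k \<omega>)" for \<omega>
    unfolding rounds_f_def rounds_g_def by simp_all
  show "integrable M (\<lambda>\<omega>. real (rounds_f K T b \<omega>))" "integrable M (\<lambda>\<omega>. real (rounds_g K T b \<omega>))"
    unfolding f g by (rule int)+
  show "(\<integral>\<omega>. real (rounds_f K T b \<omega>) \<partial>M) \<le> real K * (1 + p / q)"
    "(\<integral>\<omega>. real (rounds_g K T b \<omega>) \<partial>M) \<le> real K * (1 + (1 - p) / q)"
    unfolding f g using E[of True] E[of False] by simp_all
qed

end

section \<open>The choice of parameters\<close>

lemma step_size_eq:
  fixes \<delta>f \<delta>g p q \<theta> :: real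
  assumes pos: "0 < \<delta>f" "0 < \<delta>g"
    and p: "p = \<delta>f\<^sup>2 / (\<delta>f\<^sup>2 + \<delta>g\<^sup>2)" and q: "q = \<delta>f\<^sup>2 / (\<delta>f\<^sup>2 + \<delta>g\<^sup>2)"
    and \<theta>: "\<theta> = 1 / 4 * sqrt (p * (1 - p) * q / (p * \<delta>g\<^sup>2 + (1 - p) * \<delta>f\<^sup>2))"
  shows "\<theta> = q / (sqrt 32 * \<delta>f)"
proof -
  define S where "S = \<delta>f\<^sup>2 + \<delta>g\<^sup>2"
  have S: "0 < S" using pos by (simp add: S_def add_pos_pos)
  have "\<delta>g\<^sup>2 / S = (S - \<delta>f\<^sup>2) / S" by (simp add: S_def)
  then have p1: "1 - p = \<delta>g\<^sup>2 / S"
    using S unfolding p S_def[symmetric] by (simp add: diff_divide_distrib)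
  have pq: "p = \<delta>f\<^sup>2 / S" "q = \<delta>f\<^sup>2 / S" by (simp_all add: p q S_def)
  have quotient: "p * (1 - p) * q / (p * \<delta>g\<^sup>2 + (1 - p) * \<delta>f\<^sup>2) = (\<delta>f / S)\<^sup>2 / 2"
    unfolding p1 unfolding pq using pos S by (simp add: field_simps power2_eq_square)
  have "\<theta> = 1 / 4 * (\<delta>f / S / sqrt 2)"
    unfolding \<theta> quotient using pos S by (simp add: real_sqrt_divide)
  moreover have "sqrt 32 = 4 * sqrt (2::real)"
    using real_sqrt_mult[of 16 "2::real"] by simp
  ultimately show ?thesis unfolding pq using pos S by (simp add: field_simps power2_eq_square)
qed

text \<open>
  Here \<open>\<kappa>\<close> stands for \<open>\<delta>f / \<mu>\<close>, \<open>r\<close> for the contraction rate \<open>\<rho>/2\<close> and \<open>L\<close> for \<open>ln (2 (h(x\<^sub>0) - h(x\<^sub>*)) / \<epsilon>)\<close>,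
  which exceeds \<open>ln 2\<close>. This lower bound on \<open>L\<close> absorbs the rounding up to an integer.
\<close>

lemma epochs_needed:
  fixes r \<kappa> L :: real
  assumes r: "0 < r" "r \<le> 1" and \<kappa>: "1 \<le> \<kappa>" "1 \<le> 30 * \<kappa> * r" and L: "1 / 2 \<le> L"
  defines "K \<equiv> nat \<lceil>L / ln (1 + r)\<rceil>"
  shows "exp L \<le> (1 + r) ^ K" and "real K \<le> 62 * \<kappa> * L"
proof -
  have ln0: "0 < ln (1 + r)" using r by simp
  have K: "L / ln (1 + r) \<le> real K" "real K \<le> L / ln (1 + r) + 1"
    using L ln0 unfolding K_def by (auto simp: of_nat_nat of_int_ceiling_le_add_one)
  have "exp L \<le> exp (real K * ln (1 + r))" using K(1) ln0 by (simp add: field_simps)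
  also have "\<dots> = (1 + r) ^ K" using r by (simp add: exp_of_nat_mult)
  finally show "exp L \<le> (1 + r) ^ K" .
  have "- ln (1 + r) \<le> 1 / (1 + r) - 1"
    using ln_le_minus_one[of "1 / (1 + r)"] r by (simp add: ln_div)
  moreover have "1 - 1 / (1 + r) = r / (1 + r)" using r by (simp add: field_simps)
  moreover have "r / 2 \<le> r / (1 + r)" using r by (intro divide_left_mono) auto
  ultimately have "r / 2 \<le> ln (1 + r)" by linarith
  then have "30 * \<kappa> * r \<le> 60 * \<kappa> * ln (1 + r)" using \<kappa>(1) by simp
  then have "1 \<le> 60 * \<kappa> * ln (1 + r)" using \<kappa>(2) by linarith
  then have "L * 1 \<le> L * (60 * \<kappa> * ln (1 + r))" using L by (intro mult_left_mono) auto
  then have "L / ln (1 + r) \<le> 60 * \<kappa> * L" using ln0 by (simp add: field_simps)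
  moreover have "1 \<le> 2 * \<kappa> * L"
    using mult_mono[of 1 \<kappa> "1 / 2" L] \<kappa>(1) L by simp
  ultimately show "real K \<le> 62 * \<kappa> * L" using K(2) by linarith
qed

theorem theorem2:
  fixes fm gm :: "nat \<Rightarrow> real^'d \<Rightarrow> real" and Mf Mg :: "nat set"
    and f g h :: "real^'d \<Rightarrow> real" and x0 xs :: "real^'d"
    and \<mu> \<delta>f \<delta>g p q \<theta> \<epsilon> :: real
  assumes nodes: "finite Mf" "finite Mg" "1 \<in> Mf" "1 \<in> Mg"
    and diff_f: "\<And>m. m \<in> Mf \<Longrightarrow> twice_differentiable (fm m)"
    and diff_g: "\<And>m. m \<in> Mg \<Longrightarrow> twice_differentiable (gm m)"
    and f: "f = average Mf fm"
    and g: "g = average Mg gm"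
    and h: "h = (\<lambda>x. f x + g x)"
    and \<mu>: "\<mu> > 0" "strongly_convex \<mu> h"
    and minimizer: "is_arg_min h (\<lambda>_. True) xs"
    and sim_f: "\<And>x. spectral_norm (hess (fm 1) x - hess f x) \<le> \<delta>f"
    and sim_g: "\<And>x. spectral_norm (hess (gm 1) x - hess g x) \<le> \<delta>g"
    and order: "\<mu> < \<delta>f" "\<delta>f < \<delta>g"
    and p: "p = \<delta>f\<^sup>2 / (\<delta>f\<^sup>2 + \<delta>g\<^sup>2)"
    and q: "q = \<delta>f\<^sup>2 / (\<delta>f\<^sup>2 + \<delta>g\<^sup>2)"
    and \<theta>: "\<theta> = 1 / 4 * sqrt (p * (1 - p) * q / (p * \<delta>g\<^sup>2 + (1 - p) * \<delta>f\<^sup>2))"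
    and \<epsilon>: "0 < \<epsilon>" "\<epsilon> < h x0 - h xs"
  shows "\<exists>K. \<forall>(M :: 'w measure) F T b x y.
           vrcs_run M K f (fm 1) g (gm 1) p q \<theta> \<mu> x0 F T b x y \<longrightarrow>
             (integrable M (\<lambda>\<omega>. h (x K \<omega>) - h xs) \<and>
              (\<integral>\<omega>. h (x K \<omega>) - h xs \<partial>M) \<le> \<epsilon>) \<and>
             (integrable M (\<lambda>\<omega>. real (rounds_f K T b \<omega>)) \<and>
              (\<integral>\<omega>. real (rounds_f K T b \<omega>) \<partial>M)
                \<le> 1000 * (\<delta>f / \<mu> * ln (2 * (h x0 - h xs) / \<epsilon>))) \<and>
             (integrable M (\<lambda>\<omega>. real (rounds_g K T b \<omega>)) \<and>
              (\<integral>\<omega>. real (rounds_g K T b \<omega>) \<partial>M)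
                \<le> 1000 * ((\<delta>g / \<delta>f) * (\<delta>g / \<mu>) * ln (2 * (h x0 - h xs) / \<epsilon>)))"
proof -
  define S where "S = \<delta>f\<^sup>2 + \<delta>g\<^sup>2"
  have pos: "0 < \<delta>f" "0 < \<delta>g" using \<mu>(1) order by auto
  have S: "0 < S" using pos by (simp add: S_def add_pos_pos)
  have "\<delta>g\<^sup>2 / S = (S - \<delta>f\<^sup>2) / S" by (simp add: S_def)
  then have pq: "p = \<delta>f\<^sup>2 / S" "q = \<delta>f\<^sup>2 / S" "1 - p = \<delta>g\<^sup>2 / S"
    using S unfolding p q S_def[symmetric] by (simp_all add: diff_divide_distrib)
  have p01: "0 < p" "p < 1"
    using pos S zero_less_divide_iff[of "\<delta>g\<^sup>2" S] unfolding pq(3)[symmetric] by (simp_all add: pq(1))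
  have q01: "0 < q" "q < 1" using p01 unfolding p q by auto
  have \<theta>': "\<theta> = q / (sqrt 32 * \<delta>f)" by (rule step_size_eq[OF pos p q \<theta>])
  have \<theta>0: "0 < \<theta>" unfolding \<theta>' using q01 pos by simp
  have sqrt32: "5 \<le> sqrt (32::real)" "sqrt (32::real) \<le> 6"
    by (auto intro: real_le_rsqrt real_le_lsqrt)
  interpret vrcs_problem f "fm 1" g "gm 1" p q \<theta> \<mu> \<delta>f \<delta>g xs
  proof
    show tf: "twice_differentiable f" "twice_differentiable (fm 1)"
      and tg: "twice_differentiable g" "twice_differentiable (gm 1)"
      using nodes diff_f diff_g unfolding f g by (auto intro: twice_differentiable_average)
    show "strongly_convex \<mu> (\<lambda>z. f z + g z)" using \<mu>(2) h by simp
    show "f xs + g xs \<le> f z + g z" for z using minimizer by (simp add: is_arg_min_linorder h)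
    show "norm (grad (\<lambda>z. f z - fm 1 z) x - grad (\<lambda>z. f z - fm 1 z) y) \<le> \<delta>f * norm (x - y)" for x y
      by (rule lipschitz_grad_diff[OF tf sim_f])
    show "norm (grad (\<lambda>z. g z - gm 1 z) x - grad (\<lambda>z. g z - gm 1 z) y) \<le> \<delta>g * norm (x - y)" for x y
      by (rule lipschitz_grad_diff[OF tg sim_g])
    have "\<delta>f\<^sup>2 / p = S" using pq(1) pos S by simp
    moreover have "\<delta>g\<^sup>2 / (1 - p) = S" using pq(3) pos S by simp
    moreover have "q / (16 * \<theta>\<^sup>2) = 2 * S"
      unfolding \<theta>' pq(2) using pos S by (simp add: power_divide power_mult_distrib field_simps power2_eq_square)
    ultimately show "\<delta>f\<^sup>2 / p + \<delta>g\<^sup>2 / (1 - p) \<le> q / (16 * \<theta>\<^sup>2)" by simp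
    have "\<mu> * \<theta> \<le> \<delta>f * \<theta>" using order(1) \<theta>0 by simp
    also have "\<dots> = q / sqrt 32" unfolding \<theta>' using pos by simp
    also have "\<dots> \<le> q / 5" using sqrt32(1) q01 by (intro divide_left_mono) auto
    finally show "\<mu> * \<theta> \<le> q / 5" .
  qed (use \<mu> pos p01 q01 \<theta>0 in auto)
  define L where "L = ln (2 * (h x0 - h xs) / \<epsilon>)"
  have ratio: "2 \<le> 2 * (h x0 - h xs) / \<epsilon>" using \<epsilon> by (simp add: field_simps)
  have "ln 2 \<le> L" unfolding L_def using ratio by (subst ln_le_cancel_iff) auto
  then have L: "1 / 2 \<le> L" using ln2_ge_two_thirds by linarith
  have expL: "exp L = 2 * (h x0 - h xs) / \<epsilon>" unfolding L_def using ratio by simp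
  have "\<rho> = 2 * \<mu> * \<theta> / (5 * q)" by (rule \<rho>_def)
  also have "\<dots> = 2 / (5 * sqrt 32) * (\<mu> / \<delta>f)"
    unfolding \<theta>' using q01 pos by (simp add: field_simps)
  finally have "30 * (\<delta>f / \<mu>) * (\<rho> / 2) = 6 / sqrt 32" using pos \<mu>(1) by simp
  moreover have "1 \<le> 6 / sqrt (32::real)" using sqrt32 by simp
  ultimately have "1 \<le> 30 * (\<delta>f / \<mu>) * (\<rho> / 2)" by simp
  moreover define K where "K = nat \<lceil>L / ln (1 + \<rho> / 2)\<rceil>"
  ultimately have K: "exp L \<le> (1 + \<rho> / 2) ^ K" "real K \<le> 62 * (\<delta>f / \<mu>) * L"
    using epochs_needed[of "\<rho> / 2" "\<delta>f / \<mu>" L] \<rho>_pos \<rho>_le_1 order(1) \<mu>(1) L by auto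
  have f_rounds: "real K * (1 + p / q) \<le> 1000 * (\<delta>f / \<mu> * L)"
  proof -
    have "p / q = 1" using trans[OF p q[symmetric]] q01 by simp
    moreover have "0 \<le> \<delta>f / \<mu> * L" using pos \<mu>(1) L by simp
    ultimately show ?thesis using K(2) by simp
  qed
  have g_rounds: "real K * (1 + (1 - p) / q) \<le> 1000 * ((\<delta>g / \<delta>f) * (\<delta>g / \<mu>) * L)"
  proof -
    have gf: "1 \<le> \<delta>g\<^sup>2 / \<delta>f\<^sup>2" using order(2) pos by (simp add: power_mono)
    have "(1 - p) / q = \<delta>g\<^sup>2 / \<delta>f\<^sup>2" using S by (simp add: pq(2,3))
    then have "real K * (1 + (1 - p) / q) \<le> real K * (2 * (\<delta>g\<^sup>2 / \<delta>f\<^sup>2))"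
      using gf by (intro mult_left_mono) auto
    also have "\<dots> \<le> 62 * (\<delta>f / \<mu>) * L * (2 * (\<delta>g\<^sup>2 / \<delta>f\<^sup>2))"
      using K(2) by (intro mult_right_mono) auto
    also have "\<dots> = 124 * ((\<delta>g / \<delta>f) * (\<delta>g / \<mu>) * L)"
      using pos \<mu>(1) by (simp add: field_simps power2_eq_square)
    also have "\<dots> \<le> 1000 * ((\<delta>g / \<delta>f) * (\<delta>g / \<mu>) * L)"
      using pos \<mu>(1) L by (intro mult_right_mono) auto
    finally show ?thesis .
  qed
  have gap: "2 * (h x0 - h xs) / (1 + \<rho> / 2) ^ K \<le> \<epsilon>"
  proof -
    have "2 * (h x0 - h xs) \<le> \<epsilon> * (1 + \<rho> / 2) ^ K"
      using K(1) \<epsilon>(1) unfolding expL by (simp add: field_simps)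
    then show ?thesis using \<rho>_pos by (simp add: pos_divide_le_eq)
  qed
  show ?thesis
  proof (intro exI[of _ K] allI impI)
    fix M :: "'w measure" and F T b x y
    assume "vrcs_run M K f (fm 1) g (gm 1) p q \<theta> \<mu> x0 F T b x y"
    then interpret run: vrcs_run M K f "fm 1" g "gm 1" p q \<theta> \<mu> x0 F T b x y .
    interpret vrcs_analysis f "fm 1" g "gm 1" p q \<theta> \<mu> \<delta>f \<delta>g xs M K x0 F T b x y ..
    show "(integrable M (\<lambda>\<omega>. h (x K \<omega>) - h xs) \<and>
              (\<integral>\<omega>. h (x K \<omega>) - h xs \<partial>M) \<le> \<epsilon>) \<and>
             (integrable M (\<lambda>\<omega>. real (rounds_f K T b \<omega>)) \<and>
              (\<integral>\<omega>. real (rounds_f K T b \<omega>) \<partial>M)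
                \<le> 1000 * (\<delta>f / \<mu> * ln (2 * (h x0 - h xs) / \<epsilon>))) \<and>
             (integrable M (\<lambda>\<omega>. real (rounds_g K T b \<omega>)) \<and>
              (\<integral>\<omega>. real (rounds_g K T b \<omega>) \<partial>M)
                \<le> 1000 * ((\<delta>g / \<delta>f) * (\<delta>g / \<mu>) * ln (2 * (h x0 - h xs) / \<epsilon>)))"
      using integrable_output_gap order_trans[OF expected_output_gap gap[unfolded h]]
        integrable_rounds_f order_trans[OF expected_rounds_f f_rounds]
        integrable_rounds_g order_trans[OF expected_rounds_g g_rounds]
      unfolding L_def h by blast
  qed
qed

end
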